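(* Let $M$ be a torus of revolution in $\mathrm{Nil}$. Then $E(M)>0$.
   Context: $\mathrm{Nil}$ is the three-dimensional Heisenberg group of real upper triangular matrices $\begin{pmatrix}1&x&z\\0&1&y\\0&0&1\end{pmatrix}$ with the left-invariant Riemannian metric $ds^2=dx^2+dy^2+(dz-x\,dy)^2$. Let $e_1,e_2,e_3$ be the left-invariant orthonormal frame which at the identity equals $\partial_x,\partial_y,\partial_z$. Cylindrical coordinates $(\rho,\phi,h)$ on $\mathrm{Nil}$ are given by $x=\rho\cos\phi$, $y=\rho\sin\phi$, $z=\frac{\rho^2}{2}\cos\phi\sin\phi+h$; the metric becomes $d\rho^2-\rho^2\,dh\,d\phi+\frac14\rho^2(4+\rho^2)d\phi^2+dh^2$ and the rotations $\phi\mapsto\phi+\theta$ around the $z$-axis are isometries. A torus of revolution is a smooth closed surface diffeomorphic to a two-dimensional torus obtained by revolving a smooth curve around the $z$-axis (i.e. by applying all these rotations to it). For an oriented surface in $\mathrm{Nil}$ with unit normal $n$: $n_3=\langle n,e_3\rangle$, $H$ is the mean curvature (half the sum of the principal curvatures), $d\mu$ is the induced area measure, and for a closed oriented surface $M$ the spinor energy is $E(M)=\frac14\int_M\big(H^2-\frac{n_3^2}{4}\big)d\mu$. *)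

theory Defs
  imports "HOL-Analysis.Analysis"
begin

section \<open>Smooth maps\<close>

text \<open>\<^term>\<open>C_k k f\<close>: all iterated directional derivatives of \<^term>\<open>f\<close> up to order \<^term>\<open>k\<close>
  exist and are continuous.\<close>

primrec C_k :: "nat \<Rightarrow> ('a::euclidean_space \<Rightarrow> 'b::real_normed_vector) \<Rightarrow> bool" where
  "C_k 0 f \<longleftrightarrow> continuous_on UNIV f"
| "C_k (Suc k) f \<longleftrightarrow>
     (\<forall>x. f differentiable (at x)) \<and> (\<forall>v. C_k k (\<lambda>x. frechet_derivative f (at x) v))"

definition smooth :: "('a::euclidean_space \<Rightarrow> 'b::real_normed_vector) \<Rightarrow> bool" where
  "smooth f \<longleftrightarrow> (\<forall>k. C_k k f)"

definition partial_deriv :: "'n::finite \<Rightarrow> (real ^ 'n \<Rightarrow> 'b::real_normed_vector) \<Rightarrow> real ^ 'n \<Rightarrow> 'b" where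
  "partial_deriv i f p = frechet_derivative f (at p) (axis i 1)"


section \<open>The Heisenberg group\<close>

text \<open>A point of \<open>Nil\<close> is the vector \<open>(x, y, z)\<close> of the entries of its matrix.\<close>

type_synonym nil = "real ^ 3"

definition heis_matrix :: "nil \<Rightarrow> real ^ 3 ^ 3" where
  "heis_matrix p = vector [vector [1, p $ 1, p $ 3], vector [0, 1, p $ 2], vector [0, 0, 1]]"

definition nil_mult :: "nil \<Rightarrow> nil \<Rightarrow> nil" where
  "nil_mult p q = vector [p $ 1 + q $ 1, p $ 2 + q $ 2, p $ 3 + q $ 3 + p $ 1 * q $ 2]"

lemma heis_matrix_mult: "heis_matrix p ** heis_matrix q = heis_matrix (nil_mult p q)"
  by (simp add: heis_matrix_def nil_mult_def matrix_matrix_mult_def vec_eq_iff forall_3 sum_3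
      vector_3)

text \<open>The metric \<open>dx\<^sup>2 + dy\<^sup>2 + (dz - x dy)\<^sup>2\<close> at \<open>p\<close>; tangent vectors are given by their
  components in the coordinate frame \<open>\<partial>\<^sub>x, \<partial>\<^sub>y, \<partial>\<^sub>z\<close>.\<close>

definition nil_metric :: "nil \<Rightarrow> real ^ 3 \<Rightarrow> real ^ 3 \<Rightarrow> real" where
  "nil_metric p u v =
     u $ 1 * v $ 1 + u $ 2 * v $ 2 + (u $ 3 - p $ 1 * u $ 2) * (v $ 3 - p $ 1 * v $ 2)"

text \<open>The left-invariant frame: coordinate vectors at the identity \<^term>\<open>0 :: nil\<close>, moved to \<open>p\<close>
  by the differential of left translation.\<close>

definition nil_frame :: "3 \<Rightarrow> nil \<Rightarrow> real ^ 3" where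
  "nil_frame i p = frechet_derivative (nil_mult p) (at 0) (axis i 1)"

lemma nil_frame_eq:
  "nil_frame 1 p = vector [1, 0, 0]"
  "nil_frame 2 p = vector [0, 1, p $ 1]"
  "nil_frame 3 p = vector [0, 0, 1]"
proof -
  let ?L = "\<lambda>v. vector [v $ 1, v $ 2, v $ 3 + p $ 1 * v $ 2] :: real ^ 3"
  have lin: "linear ?L"
    by (rule linearI) (simp_all add: vec_eq_iff forall_3 vector_3 algebra_simps)
  have "nil_mult p = (\<lambda>q. p + ?L q)"
    by (simp add: fun_eq_iff nil_mult_def vec_eq_iff forall_3 vector_3)
  moreover have "((\<lambda>q. p + ?L q) has_derivative ?L) (at 0)"
    using has_derivative_add[OF has_derivative_const[of p "at 0"] linear_imp_has_derivative[OF lin]]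
    by simp
  ultimately have "(nil_mult p has_derivative ?L) (at 0)"
    by simp
  then have "frechet_derivative (nil_mult p) (at 0) = ?L"
    by (rule frechet_derivative_at[symmetric])
  then show "nil_frame 1 p = vector [1, 0, 0]" "nil_frame 2 p = vector [0, 1, p $ 1]"
    "nil_frame 3 p = vector [0, 0, 1]"
    by (simp_all add: nil_frame_def axis_def vec_eq_iff forall_3 vector_3)
qed

lemma nil_frame_orthonormal:
  "nil_metric p (nil_frame i p) (nil_frame j p) = (if i = j then 1 else 0)"
proof -
  have "\<forall>i j. nil_metric p (nil_frame i p) (nil_frame j p) = (if i = j then 1 else 0)"
    by (simp add: forall_3 nil_frame_eq nil_metric_def vector_3)
  then show ?thesis by blast
qed

text \<open>Christoffel symbols
  \<open>\<Gamma>\<^sup>k\<^sub>i\<^sub>j = 1/2 \<Sum>\<^sub>l g\<^sup>k\<^sup>l (\<partial>\<^sub>i g\<^sub>j\<^sub>l + \<partial>\<^sub>j g\<^sub>i\<^sub>l - \<partial>\<^sub>l g\<^sub>i\<^sub>j)\<close> of the Levi-Civita connection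
  in the coordinates \<open>(x, y, z)\<close>.\<close>

definition nil_gram :: "nil \<Rightarrow> real ^ 3 ^ 3" where
  "nil_gram p = (\<chi> i j. nil_metric p (axis i 1) (axis j 1))"

definition christoffel :: "3 \<Rightarrow> 3 \<Rightarrow> 3 \<Rightarrow> nil \<Rightarrow> real" where
  "christoffel k i j p = 1 / 2 * (\<Sum>l\<in>UNIV. matrix_inv (nil_gram p) $ k $ l *
     (partial_deriv i (\<lambda>q. nil_gram q $ j $ l) p + partial_deriv j (\<lambda>q. nil_gram q $ i $ l) p
       - partial_deriv l (\<lambda>q. nil_gram q $ i $ j) p))"


section \<open>Parametrised surfaces\<close>

text \<open>A unit normal field along \<open>F\<close> that descends to the image of \<open>F\<close>.  Choosing it amounts to
  choosing an orientation.\<close>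

definition unit_normal_field :: "(real ^ 2 \<Rightarrow> nil) \<Rightarrow> (real ^ 2 \<Rightarrow> real ^ 3) \<Rightarrow> bool" where
  "unit_normal_field F n \<longleftrightarrow>
     continuous_on UNIV n \<and>
     (\<forall>s t. F s = F t \<longrightarrow> n s = n t) \<and>
     (\<forall>t. nil_metric (F t) (n t) (n t) = 1) \<and>
     (\<forall>t i. nil_metric (F t) (n t) (partial_deriv i F t) = 0)"

definition first_ff :: "(real ^ 2 \<Rightarrow> nil) \<Rightarrow> real ^ 2 \<Rightarrow> real ^ 2 ^ 2" where
  "first_ff F t = (\<chi> i j. nil_metric (F t) (partial_deriv i F t) (partial_deriv j F t))"

text \<open>The ambient covariant derivative of \<open>\<partial>\<^sub>j F\<close> in direction \<open>\<partial>\<^sub>i F\<close>.\<close>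

definition cov_deriv2 :: "(real ^ 2 \<Rightarrow> nil) \<Rightarrow> 2 \<Rightarrow> 2 \<Rightarrow> real ^ 2 \<Rightarrow> real ^ 3" where
  "cov_deriv2 F i j t = partial_deriv i (partial_deriv j F) t +
     (\<chi> k. \<Sum>a\<in>UNIV. \<Sum>b\<in>UNIV. christoffel k a b (F t) * partial_deriv i F t $ a * partial_deriv j F t $ b)"

definition second_ff :: "(real ^ 2 \<Rightarrow> nil) \<Rightarrow> (real ^ 2 \<Rightarrow> real ^ 3) \<Rightarrow> real ^ 2 \<Rightarrow> real ^ 2 ^ 2" where
  "second_ff F n t = (\<chi> i j. nil_metric (F t) (cov_deriv2 F i j t) (n t))"

definition shape_operator ::
    "(real ^ 2 \<Rightarrow> nil) \<Rightarrow> (real ^ 2 \<Rightarrow> real ^ 3) \<Rightarrow> real ^ 2 \<Rightarrow> real ^ 2 ^ 2" where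
  "shape_operator F n t = matrix_inv (first_ff F t) ** second_ff F n t"

definition principal_curvatures ::
    "(real ^ 2 \<Rightarrow> nil) \<Rightarrow> (real ^ 2 \<Rightarrow> real ^ 3) \<Rightarrow> real ^ 2 \<Rightarrow> real set" where
  "principal_curvatures F n t = {k. \<exists>v. v \<noteq> 0 \<and> shape_operator F n t *v v = k *s v}"

text \<open>At an umbilic point the set of principal curvatures is a singleton; \<open>Min\<close> and \<open>Max\<close> then
  count its element twice.\<close>

definition mean_curvature :: "(real ^ 2 \<Rightarrow> nil) \<Rightarrow> (real ^ 2 \<Rightarrow> real ^ 3) \<Rightarrow> real ^ 2 \<Rightarrow> real" where
  "mean_curvature F n t =
     (Min (principal_curvatures F n t) + Max (principal_curvatures F n t)) / 2"

definition n3 :: "(real ^ 2 \<Rightarrow> nil) \<Rightarrow> (real ^ 2 \<Rightarrow> real ^ 3) \<Rightarrow> real ^ 2 \<Rightarrow> real" where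
  "n3 F n t = nil_metric (F t) (n t) (nil_frame 3 (F t))"

definition area_density :: "(real ^ 2 \<Rightarrow> nil) \<Rightarrow> real ^ 2 \<Rightarrow> real" where
  "area_density F t = sqrt (det (first_ff F t))"


section \<open>Tori\<close>

text \<open>\<open>F\<close> induces an injective immersion of the torus \<open>\<real>\<^sup>2/\<int>\<^sup>2\<close>, hence, the torus being compact,
  a diffeomorphism onto the embedded closed surface \<open>M\<close>.\<close>

definition torus_parametrization :: "nil set \<Rightarrow> (real ^ 2 \<Rightarrow> nil) \<Rightarrow> bool" where
  "torus_parametrization M F \<longleftrightarrow>
     smooth F \<and>
     (\<forall>s t. F s = F t \<longleftrightarrow> (\<forall>i. s $ i - t $ i \<in> \<int>)) \<and>
     (\<forall>t. inj (frechet_derivative F (at t))) \<and>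
     range F = M"

text \<open>The spinor energy of the torus parametrised by \<open>F\<close> and oriented by \<open>n\<close>; the unit square
  \<^term>\<open>cbox 0 1 :: (real ^ 2) set\<close> is a fundamental domain of the lattice \<open>\<int>\<^sup>2\<close>.\<close>

definition spinor_energy :: "(real ^ 2 \<Rightarrow> nil) \<Rightarrow> (real ^ 2 \<Rightarrow> real ^ 3) \<Rightarrow> real" where
  "spinor_energy F n = 1 / 4 *
     integral (cbox 0 1) (\<lambda>t. ((mean_curvature F n t)\<^sup>2 - (n3 F n t)\<^sup>2 / 4) * area_density F t)"

definition cyl :: "real \<Rightarrow> real \<Rightarrow> real \<Rightarrow> nil" where
  "cyl \<rho> \<phi> h = vector [\<rho> * cos \<phi>, \<rho> * sin \<phi>, \<rho>\<^sup>2 / 2 * cos \<phi> * sin \<phi> + h]"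

text \<open>The union of the images of \<open>C\<close> under all rotations \<open>\<phi> \<mapsto> \<phi> + \<theta>\<close> around the \<open>z\<close>-axis.\<close>

definition revolve :: "nil set \<Rightarrow> nil set" where
  "revolve C = {cyl \<rho> (\<phi> + \<theta>) h | \<rho> \<phi> h \<theta>. 0 \<le> \<rho> \<and> cyl \<rho> \<phi> h \<in> C}"

definition torus_of_revolution :: "nil set \<Rightarrow> bool" where
  "torus_of_revolution M \<longleftrightarrow>
     (\<exists>F. torus_parametrization M F) \<and>
     (\<exists>c I. smooth (c :: real \<Rightarrow> nil) \<and> is_interval I \<and> M = revolve (c ` I))"

end

theory Submission
  imports Defs
begin

text \<open>
Why the energy is positive. Describe a surface of revolution by its profile curve in the quotient
by the rotations, parametrised by arc length, with distance \<open>\<rho>\<close> from the axis and with angle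
\<open>\<sigma>\<close> between the curve and the radial direction, and put \<open>S = sqrt (4 + \<rho>\<^sup>2)\<close>. Then
\<open>\<rho>' = cos \<sigma>\<close>, \<open>2 H = \<sigma>' + sin \<sigma> / \<rho>\<close>, \<open>n\<^sub>3 = 2 cos \<sigma> / S\<close>, the area element is
\<open>\<rho> S / 2 ds d\<phi>\<close>, and \<open>8 (H\<^sup>2 - n\<^sub>3\<^sup>2 / 4)\<close> times the area element is
\<open>((\<sigma>' + sin \<sigma> / \<rho>)\<^sup>2 - 4 cos\<^sup>2 \<sigma> / S\<^sup>2) \<rho> S ds d\<phi>\<close>.
Adding the derivative of \<open>4 (S - 2) cos \<sigma>\<close> removes the negative term and leaves the density
\<open>\<rho> (2 (\<sigma>' + sin \<sigma> / \<rho>)\<^sup>2 + (S - 2) (\<sigma>' - sin \<sigma> / \<rho>)\<^sup>2)\<close>,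
which is nonnegative, and positive where \<open>\<rho>\<close> is maximal because \<open>sin \<sigma> = \<plusminus> 1\<close> there. The added
function vanishes on the axis, so the argument does not depend on whether the surface meets it.

The parametrisation \<open>F\<close> of the torus is arbitrary, and it need not be adapted to the rotations.
The argument is therefore carried out on the parameter plane. The derivative of
\<open>4 (S - 2) cos \<sigma>\<close> becomes the exterior derivative of the periodic one-form \<open>\<omega> = 4 (S - 2) cos \<sigma> d\<phi>\<close>,
whose integral over the unit square vanishes (\<open>integral_partial_deriv_periodic\<close>). What
replaces the profile curve is the tangency of the rotation field: a rotation orbit stays in the
embedded torus, so its velocity is tangent (\<open>velocity_in_tangent_plane\<close>). This one scalar
equation for the unit normal, together with its first derivatives, gives the derivative of the
normal along the rotation field (\<open>normal_derivative_along_rotation\<close>) and from it the exterior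
derivative of \<open>\<omega>\<close> in terms of \<open>H\<close> and \<open>n\<^sub>3\<close> (\<open>wedge_identity\<close>). The positivity of the resulting
density is \<open>energy_density_off_axis\<close>. Finally, \<open>mean_curvature_eq\<close> identifies the mean curvature
defined through Christoffel symbols and eigenvalues with half the trace of the negative
derivative of the normal in the left-invariant frame, up to the sign that depends on the orientation.
\<close>

unbundle cross3_syntax

section \<open>Calculus of partial derivatives\<close>

lemma C_k_1:
  "C_k 1 f \<longleftrightarrow> (\<forall>t. f differentiable (at t)) \<and>
     (\<forall>v. continuous_on UNIV (\<lambda>t. frechet_derivative f (at t) v))"
  by simp

lemma C_k_1_differentiable: "C_k 1 f \<Longrightarrow> f differentiable (at t)"
  by simp

lemma C_k_1_I:
  assumes "\<And>t. (f has_derivative f' t) (at t)" and "\<And>v. continuous_on UNIV (\<lambda>t. f' t v)"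
  shows "C_k 1 f"
proof -
  have "frechet_derivative f (at t) = f' t" for t
    using assms(1) by (metis frechet_derivative_at)
  then show ?thesis
    unfolding C_k_1 using assms by (auto simp: differentiable_def)
qed

lemma continuous_on_C_k_1: "C_k 1 f \<Longrightarrow> continuous_on UNIV f"
  by (metis C_k_1_differentiable continuous_at_imp_continuous_on differentiable_imp_continuous_within)

lemma continuous_on_partial_deriv: "C_k 1 f \<Longrightarrow> continuous_on UNIV (partial_deriv i f)"
  unfolding partial_deriv_def by (subst (asm) C_k_1) (simp add: fun_eq_iff)

lemma smooth_C_k_1: "smooth f \<Longrightarrow> C_k 1 f"
  unfolding smooth_def by blast

lemma smooth_partial_deriv: "smooth f \<Longrightarrow> smooth (partial_deriv i f)"
  unfolding smooth_def
proof
  fix k assume "\<forall>k. C_k k f"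
  then have "C_k (Suc k) f" by blast
  then show "C_k k (partial_deriv i f)"
    by (simp add: partial_deriv_def[abs_def])
qed

lemma has_derivative_frechet_C_k_1:
  "C_k 1 f \<Longrightarrow> (f has_derivative frechet_derivative f (at t)) (at t)"
  using C_k_1_differentiable frechet_derivative_works by blast

lemma partial_deriv_eq: "(f has_derivative f') (at t) \<Longrightarrow> partial_deriv i f t = f' (axis i 1)"
  unfolding partial_deriv_def by (metis frechet_derivative_at)

lemma C_k_1_const: "C_k 1 (\<lambda>t. c)"
  by (rule C_k_1_I[where f'="\<lambda>_ _. 0"]) auto

lemma partial_deriv_const: "partial_deriv i (\<lambda>t. c) t = 0"
  by (rule partial_deriv_eq[where f'="\<lambda>_. 0"]) auto

lemma C_k_1_add:
  assumes "C_k 1 f" "C_k 1 g"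
  shows "C_k 1 (\<lambda>t. f t + g t)"
  by (rule C_k_1_I, rule has_derivative_add[OF assms[THEN has_derivative_frechet_C_k_1]])
    (use assms in \<open>auto intro!: continuous_intros\<close>)

lemma partial_deriv_add:
  assumes "C_k 1 f" "C_k 1 g"
  shows "partial_deriv i (\<lambda>t. f t + g t) t = partial_deriv i f t + partial_deriv i g t"
  by (subst partial_deriv_eq[OF has_derivative_add[OF assms[THEN has_derivative_frechet_C_k_1]]])
    (simp add: partial_deriv_def)

lemma C_k_1_diff:
  assumes "C_k 1 f" "C_k 1 g"
  shows "C_k 1 (\<lambda>t. f t - g t)"
  by (rule C_k_1_I, rule has_derivative_diff[OF assms[THEN has_derivative_frechet_C_k_1]])
    (use assms in \<open>auto intro!: continuous_intros\<close>)

lemma partial_deriv_diff: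
  assumes "C_k 1 f" "C_k 1 g"
  shows "partial_deriv i (\<lambda>t. f t - g t) t = partial_deriv i f t - partial_deriv i g t"
  by (subst partial_deriv_eq[OF has_derivative_diff[OF assms[THEN has_derivative_frechet_C_k_1]]])
    (simp add: partial_deriv_def)

lemma C_k_1_linear:
  assumes "bounded_linear L" "C_k 1 f"
  shows "C_k 1 (\<lambda>t. L (f t))"
proof (rule C_k_1_I)
  show "((\<lambda>t. L (f t)) has_derivative (\<lambda>v. L (frechet_derivative f (at t) v))) (at t)" for t
    by (rule bounded_linear.has_derivative[OF assms(1) has_derivative_frechet_C_k_1[OF assms(2)]])
  show "continuous_on UNIV (\<lambda>t. L (frechet_derivative f (at t) v))" for v
    using assms by (auto intro: bounded_linear.continuous_on)
qed

lemma partial_deriv_linear: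
  assumes "bounded_linear L" "C_k 1 f"
  shows "partial_deriv i (\<lambda>t. L (f t)) t = L (partial_deriv i f t)"
  by (subst partial_deriv_eq[OF
        bounded_linear.has_derivative[OF assms(1) has_derivative_frechet_C_k_1[OF assms(2)]]])
    (simp add: partial_deriv_def)

lemma C_k_1_bilinear:
  assumes h: "bounded_bilinear h" and f: "C_k 1 f" and g: "C_k 1 g"
  shows "C_k 1 (\<lambda>t. h (f t) (g t))"
proof (rule C_k_1_I)
  show "((\<lambda>t. h (f t) (g t)) has_derivative
      (\<lambda>v. h (f t) (frechet_derivative g (at t) v) + h (frechet_derivative f (at t) v) (g t))) (at t)" for t
    by (rule bounded_bilinear.FDERIV[OF h f[THEN has_derivative_frechet_C_k_1] g[THEN has_derivative_frechet_C_k_1]])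
  show "continuous_on UNIV
      (\<lambda>t. h (f t) (frechet_derivative g (at t) v) + h (frechet_derivative f (at t) v) (g t))" for v
    using f g continuous_on_C_k_1[OF f] continuous_on_C_k_1[OF g]
    by (auto intro!: continuous_on_add bounded_bilinear.continuous_on[OF h])
qed

lemma partial_deriv_bilinear:
  assumes h: "bounded_bilinear h" and f: "C_k 1 f" and g: "C_k 1 g"
  shows "partial_deriv i (\<lambda>t. h (f t) (g t)) t =
    h (f t) (partial_deriv i g t) + h (partial_deriv i f t) (g t)"
  by (subst partial_deriv_eq[OF bounded_bilinear.FDERIV[OF h
        f[THEN has_derivative_frechet_C_k_1] g[THEN has_derivative_frechet_C_k_1]]])
    (simp add: partial_deriv_def)

lemma has_derivative_chain_real:
  fixes f :: "'a::euclidean_space \<Rightarrow> real"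
  assumes f: "C_k 1 f" and g: "(g has_real_derivative g' (f t)) (at (f t))"
  shows "((\<lambda>t. g (f t)) has_derivative (\<lambda>v. g' (f t) * frechet_derivative f (at t) v)) (at t)"
  using has_derivative_compose[OF has_derivative_frechet_C_k_1[OF f, of t]
      g[unfolded has_field_derivative_def]]
  by (simp add: mult.commute)

lemma C_k_1_chain_real:
  fixes f :: "'a::euclidean_space \<Rightarrow> real"
  assumes f: "C_k 1 f" and U: "\<And>t. f t \<in> U"
    and g: "\<And>s. s \<in> U \<Longrightarrow> (g has_real_derivative g' s) (at s)" and g': "continuous_on U g'"
  shows "C_k 1 (\<lambda>t. g (f t))"
proof (rule C_k_1_I)
  show "((\<lambda>t. g (f t)) has_derivative (\<lambda>v. g' (f t) * frechet_derivative f (at t) v)) (at t)" for t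
    by (rule has_derivative_chain_real[of f g g' t, OF f g[OF U]])
  have "continuous_on UNIV (\<lambda>t. g' (f t))"
    using U by (intro continuous_on_compose2[OF g' continuous_on_C_k_1[OF f]]) auto
  then show "continuous_on UNIV (\<lambda>t. g' (f t) * frechet_derivative f (at t) v)" for v
    using f by (auto intro!: continuous_intros)
qed

lemma partial_deriv_chain_real:
  fixes f :: "real ^ 'n \<Rightarrow> real"
  assumes f: "C_k 1 f" and g: "(g has_real_derivative g' (f t)) (at (f t))"
  shows "partial_deriv i (\<lambda>t. g (f t)) t = g' (f t) * partial_deriv i f t"
  using partial_deriv_eq[OF has_derivative_chain_real[of f g g' t, OF f g]]
  by (simp add: partial_deriv_def)

lemma bounded_bilinear_cross3: "bounded_bilinear cross3"
  by (rule bilinear_conv_bounded_bilinear[THEN iffD1, OF bilinear_cross])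

lemmas C_k_1_mult = C_k_1_bilinear[OF bounded_bilinear_mult]
lemmas C_k_1_scaleR = C_k_1_bilinear[OF bounded_bilinear_scaleR]
lemmas C_k_1_cross = C_k_1_bilinear[OF bounded_bilinear_cross3]
lemmas C_k_1_nth = C_k_1_linear[OF bounded_linear_vec_nth]

text \<open>The theorem on symmetric second derivatives and the fundamental theorem of calculus only see a
function along lines parallel to the axes, where a partial derivative is an ordinary one.\<close>

lemma partial_deriv_along_line:
  assumes "C_k 1 f"
  shows "((\<lambda>s. f (t + s *\<^sub>R axis i 1)) has_vector_derivative partial_deriv i f (t + s *\<^sub>R axis i 1)) (at s)"
proof -
  have "((\<lambda>s. t + s *\<^sub>R axis i (1::real)) has_derivative (\<lambda>s. s *\<^sub>R axis i 1)) (at s)"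
    by (auto intro!: derivative_eq_intros)
  from has_derivative_compose[OF this has_derivative_frechet_C_k_1[OF assms]]
  have *: "((\<lambda>s. f (t + s *\<^sub>R axis i 1)) has_derivative
      (\<lambda>r. frechet_derivative f (at (t + s *\<^sub>R axis i 1)) (r *\<^sub>R axis i 1))) (at s)" .
  have "linear (frechet_derivative f (at (t + s *\<^sub>R axis i 1)))"
    using has_derivative_frechet_C_k_1[OF assms] has_derivative_linear by blast
  then show ?thesis
    using * unfolding has_vector_derivative_def partial_deriv_def
    by (simp add: linear_scale)
qed

lemma partial_deriv_mean_value:
  fixes f :: "real ^ 'n \<Rightarrow> real"
  assumes "C_k 1 f" "0 < h"
  shows "\<exists>s>0. s < h \<and> f (t + h *\<^sub>R axis i 1) - f t = h * partial_deriv i f (t + s *\<^sub>R axis i 1)"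
proof -
  have d: "((\<lambda>s. f (t + s *\<^sub>R axis i 1)) has_real_derivative partial_deriv i f (t + s *\<^sub>R axis i 1)) (at s)" for s
    using partial_deriv_along_line[OF assms(1)] has_real_derivative_iff_has_vector_derivative by blast
  show ?thesis
    using MVT2[OF assms(2), of "\<lambda>s. f (t + s *\<^sub>R axis i 1)" "\<lambda>s. partial_deriv i f (t + s *\<^sub>R axis i 1)"] d
    by auto
qed

lemma partial_deriv_shift:
  assumes f: "C_k 1 f"
  shows C_k_1_shift: "C_k 1 (\<lambda>t. f (t + c))"
    and "partial_deriv i (\<lambda>t. f (t + c)) t = partial_deriv i f (t + c)"
proof -
  have d: "((\<lambda>t. f (t + c)) has_derivative frechet_derivative f (at (t + c))) (at t)" for t
  proof -
    have "((\<lambda>t. t + c) has_derivative (\<lambda>v. v)) (at t)"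
      by (auto intro!: derivative_eq_intros)
    from has_derivative_compose[OF this has_derivative_frechet_C_k_1[OF f]] show ?thesis by simp
  qed
  have "continuous_on UNIV (\<lambda>t. frechet_derivative f (at (t + c)) v)" for v
  proof (rule continuous_on_compose2[of UNIV "\<lambda>t. frechet_derivative f (at t) v" UNIV "\<lambda>t. t + c"])
    show "continuous_on UNIV (\<lambda>t. frechet_derivative f (at t) v)" using f by (simp add: C_k_1)
  qed (auto intro!: continuous_intros)
  with d show "C_k 1 (\<lambda>t. f (t + c))" by (rule C_k_1_I)
  show "partial_deriv i (\<lambda>t. f (t + c)) t = partial_deriv i f (t + c)"
    using partial_deriv_eq[OF d] by (simp add: partial_deriv_def)
qed

lemma second_difference:
  fixes f :: "real ^ 'n \<Rightarrow> real"
  assumes f: "C_k 1 f" "C_k 1 (partial_deriv i f)" and h: "0 < h"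
  shows "\<exists>r s. 0 < r \<and> r < h \<and> 0 < s \<and> s < h \<and>
    f (t + h *\<^sub>R axis i 1 + h *\<^sub>R axis j 1) - f (t + h *\<^sub>R axis i 1) - f (t + h *\<^sub>R axis j 1) + f t =
      h * h * partial_deriv j (partial_deriv i f) (t + r *\<^sub>R axis i 1 + s *\<^sub>R axis j 1)"
proof -
  let ?g = "\<lambda>t. f (t + h *\<^sub>R axis j 1) - f t"
  have "C_k 1 ?g" by (rule C_k_1_diff[OF C_k_1_shift[OF f(1)] f(1)])
  from partial_deriv_mean_value[OF this h, of t i] obtain r where r: "0 < r" "r < h"
    "?g (t + h *\<^sub>R axis i 1) - ?g t = h * partial_deriv i ?g (t + r *\<^sub>R axis i 1)" by auto
  have a: "partial_deriv i ?g (t + r *\<^sub>R axis i 1) =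
      partial_deriv i f (t + r *\<^sub>R axis i 1 + h *\<^sub>R axis j 1) - partial_deriv i f (t + r *\<^sub>R axis i 1)"
    unfolding partial_deriv_diff[OF C_k_1_shift[OF f(1)] f(1)] partial_deriv_shift(2)[OF f(1)] ..
  from partial_deriv_mean_value[OF f(2) h, of "t + r *\<^sub>R axis i 1" j] obtain s where
    s: "0 < s" "s < h" "partial_deriv i f (t + r *\<^sub>R axis i 1 + h *\<^sub>R axis j 1) - partial_deriv i f (t + r *\<^sub>R axis i 1)
      = h * partial_deriv j (partial_deriv i f) (t + r *\<^sub>R axis i 1 + s *\<^sub>R axis j 1)" by auto
  have "?g (t + h *\<^sub>R axis i 1) - ?g t =
      h * h * partial_deriv j (partial_deriv i f) (t + r *\<^sub>R axis i 1 + s *\<^sub>R axis j 1)"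
    unfolding r(3) a s(3) by (simp only: mult.assoc)
  then show ?thesis
    using r(1,2) s(1,2) by (intro exI[of _ r] exI[of _ s]) (simp add: algebra_simps)
qed

text \<open>Both iterated derivatives are the limit of one and the same second difference quotient, which is
symmetric in \<open>i\<close> and \<open>j\<close>; the intermediate points supplied by the mean value theorem tend to \<open>t\<close>.\<close>

lemma partial_deriv_commute_real:
  fixes f :: "real ^ 'n \<Rightarrow> real"
  assumes f: "C_k 1 f" "\<And>i. C_k 1 (partial_deriv i f)"
  shows "partial_deriv i (partial_deriv j f) t = partial_deriv j (partial_deriv i f) t"
proof -
  define h where "h = (\<lambda>k. inverse (real (Suc k)))"
  have h: "0 < h k" for k by (simp add: h_def)
  have h0: "h \<longlonglongrightarrow> 0" unfolding h_def by (rule LIMSEQ_inverse_real_of_nat)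
  define D where "D = (\<lambda>k. f (t + h k *\<^sub>R axis i 1 + h k *\<^sub>R axis j 1) - f (t + h k *\<^sub>R axis i 1)
     - f (t + h k *\<^sub>R axis j 1) + f t)"
  have lim: "(\<lambda>k. D k / (h k * h k)) \<longlonglongrightarrow> partial_deriv b (partial_deriv a f) t"
    if D: "\<And>k. D k = f (t + h k *\<^sub>R axis a 1 + h k *\<^sub>R axis b 1) - f (t + h k *\<^sub>R axis a 1)
     - f (t + h k *\<^sub>R axis b 1) + f t" for a b
  proof -
    have "\<forall>k. \<exists>r s. 0 < r \<and> r < h k \<and> 0 < s \<and> s < h k \<and>
      D k = h k * h k * partial_deriv b (partial_deriv a f) (t + r *\<^sub>R axis a 1 + s *\<^sub>R axis b 1)"
      unfolding D using second_difference[OF f(1) f(2) h] by blast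
    from choice[OF this] obtain r where "\<forall>k. \<exists>s. 0 < r k \<and> r k < h k \<and> 0 < s \<and> s < h k \<and>
      D k = h k * h k * partial_deriv b (partial_deriv a f) (t + r k *\<^sub>R axis a 1 + s *\<^sub>R axis b 1)" ..
    from choice[OF this] obtain s where rs: "\<forall>k. 0 < r k \<and> r k < h k \<and> 0 < s k \<and> s k < h k \<and>
      D k = h k * h k * partial_deriv b (partial_deriv a f) (t + r k *\<^sub>R axis a 1 + s k *\<^sub>R axis b 1)" ..
    have "q \<longlonglongrightarrow> 0" if "\<forall>k. 0 < q k \<and> q k < h k" for q
      using that by (intro tendsto_sandwich[OF _ _ tendsto_const h0] always_eventually)
        (auto intro: less_imp_le)
    then have "r \<longlonglongrightarrow> 0" "s \<longlonglongrightarrow> 0"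
      using rs by blast+
    then have "(\<lambda>k. t + r k *\<^sub>R axis a 1 + s k *\<^sub>R axis b 1) \<longlonglongrightarrow> t + 0 *\<^sub>R axis a 1 + 0 *\<^sub>R axis b 1"
      by (intro tendsto_intros)
    then have "(\<lambda>k. partial_deriv b (partial_deriv a f) (t + r k *\<^sub>R axis a 1 + s k *\<^sub>R axis b 1))
        \<longlonglongrightarrow> partial_deriv b (partial_deriv a f) t"
      using continuous_on_tendsto_compose[OF continuous_on_partial_deriv[OF f(2)], of _ t] by auto
    moreover have "\<And>k. D k / (h k * h k) = partial_deriv b (partial_deriv a f) (t + r k *\<^sub>R axis a 1 + s k *\<^sub>R axis b 1)"
      (is "\<And>k. ?P k")
    proof -
      fix k
      have "h k * h k \<noteq> 0" using h[of k] by simp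
      then show "?P k" using spec[OF rs, of k] by (metis nonzero_mult_div_cancel_left)
    qed
    ultimately show ?thesis by simp
  qed
  show ?thesis
  proof (rule LIMSEQ_unique)
    show "(\<lambda>k. D k / (h k * h k)) \<longlonglongrightarrow> partial_deriv i (partial_deriv j f) t"
      by (rule lim) (simp add: D_def algebra_simps)
    show "(\<lambda>k. D k / (h k * h k)) \<longlonglongrightarrow> partial_deriv j (partial_deriv i f) t"
      by (rule lim) (simp add: D_def)
  qed
qed

lemma partial_deriv_nth:
  fixes f :: "real ^ 'n \<Rightarrow> real ^ 'm"
  assumes "C_k 1 f"
  shows "partial_deriv i (\<lambda>t. f t $ k) t = partial_deriv i f t $ k"
  by (rule partial_deriv_linear[OF bounded_linear_vec_nth assms])

lemma partial_deriv_commute: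
  fixes f :: "real ^ 'n \<Rightarrow> real ^ 'm"
  assumes f: "C_k 1 f" "\<And>i. C_k 1 (partial_deriv i f)"
  shows "partial_deriv i (partial_deriv j f) t = partial_deriv j (partial_deriv i f) t"
proof -
  have "partial_deriv i (partial_deriv j f) t $ k = partial_deriv j (partial_deriv i f) t $ k" for k
  proof -
    have eq: "partial_deriv i (\<lambda>t. f t $ k) = (\<lambda>t. partial_deriv i f t $ k)" for i
      using partial_deriv_nth[OF f(1)] by auto
    have "C_k 1 (\<lambda>t. f t $ k)" "\<And>i. C_k 1 (partial_deriv i (\<lambda>t. f t $ k))"
      unfolding eq by (intro C_k_1_linear[OF bounded_linear_vec_nth] f)+
    from partial_deriv_commute_real[OF this, of i j t] show ?thesis
      unfolding eq partial_deriv_nth[OF f(2)] .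
  qed
  then show ?thesis by (simp add: vec_eq_iff)
qed

section \<open>The integral over the unit square of a derivative of a periodic function\<close>

lemma box_image_real2:
  "(\<lambda>p. vector [fst p, snd p] :: real ^ 2) ` cbox u v = cbox (vector [fst u, snd u]) (vector [fst v, snd v])"
proof -
  obtain a b c d where uv: "u = (a, b)" "v = (c, d)" by (cases u, cases v)
  have "t \<in> (\<lambda>p. vector [fst p, snd p] :: real ^ 2) ` cbox (a, b) (c, d)"
    if "t \<in> cbox (vector [a, b]) (vector [c, d])" for t
    using that by (intro image_eqI[of _ _ "(t $ 1, t $ 2)"])
      (auto simp: mem_box_cart vec_eq_iff forall_2 cbox_Pair_eq)
  then show ?thesis
    unfolding uv by (auto simp: mem_box_cart forall_2 cbox_Pair_eq)
qed

lemma box_image_prod: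
  "(\<lambda>t :: real ^ 2. (t $ 1, t $ 2)) ` cbox u v = cbox (u $ 1, u $ 2) (v $ 1, v $ 2)"
proof -
  have "p \<in> (\<lambda>t :: real ^ 2. (t $ 1, t $ 2)) ` cbox u v" if "p \<in> cbox (u $ 1, u $ 2) (v $ 1, v $ 2)" for p
    using that by (intro image_eqI[of _ _ "vector [fst p, snd p]"])
      (auto simp: mem_box_cart forall_2 cbox_Pair_eq)
  then show ?thesis
    by (auto simp: mem_box_cart forall_2 cbox_Pair_eq)
qed

lemma measure_cbox_real2:
  "measure lborel (cbox u v :: (real ^ 2) set) = measure lborel (cbox (u $ 1, u $ 2) (v $ 1, v $ 2))"
proof (cases "cbox u v = {}")
  case True
  then have "cbox (u $ 1, u $ 2) (v $ 1, v $ 2) = {}"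
    using box_image_prod[of u v] by simp
  with True show ?thesis by simp
next
  case False
  then have "u $ i \<le> v $ i" for i
    by (meson interval_ne_empty_cart(1))
  then show ?thesis
    using False by (simp add: content_cbox_cart content_Pair prod_2 UNIV_2)
qed

lemma integral_unit_square:
  fixes f :: "real ^ 2 \<Rightarrow> real"
  assumes f: "continuous_on UNIV f"
  shows "integral (cbox 0 1) f = integral (cbox 0 1) (\<lambda>a. integral (cbox 0 1) (\<lambda>b. f (vector [a, b])))"
    and "integral (cbox 0 1) f = integral (cbox 0 1) (\<lambda>b. integral (cbox 0 1) (\<lambda>a. f (vector [a, b])))"
proof -
  let ?g = "\<lambda>p. vector [fst p, snd p] :: real ^ 2" and ?h = "\<lambda>t :: real ^ 2. (t $ 1, t $ 2)"
  have cg: "continuous_on S ?g" for S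
  proof -
    have "?g = (\<lambda>p. fst p *\<^sub>R axis 1 1 + snd p *\<^sub>R axis 2 1)"
      by (auto simp: fun_eq_iff vec_eq_iff forall_2 axis_def)
    then show ?thesis by (simp only:) (intro continuous_intros)
  qed
  have "((\<lambda>p. f (?g p)) has_integral (1 / 1) *\<^sub>R integral (cbox 0 1) f) (?h ` cbox 0 1)"
  proof (rule has_integral_twiddle[where h="?h"])
    show "continuous (at x) ?g" for x using cg[of UNIV] by (simp only: continuous_on_eq_continuous_at[OF open_UNIV] UNIV_I)
    show "?h (?g x) = x" for x by (cases x) simp
    show "?g (?h x) = x" for x by (simp add: vec_eq_iff forall_2)
    show "\<exists>w z. ?g ` cbox u v = cbox w z" for u v using box_image_real2 by blast
    show "\<exists>w z. ?h ` cbox u v = cbox w z" for u v using box_image_prod by blast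
    show "measure lborel (?g ` cbox u v) = 1 * measure lborel (cbox u v)" for u v
      unfolding box_image_real2 measure_cbox_real2 by simp
    show "(f has_integral integral (cbox 0 1) f) (cbox 0 1)"
      by (intro integrable_integral integrable_continuous continuous_on_subset[OF f]) auto
  qed simp
  then have "integral (cbox (0, 0) (1, 1)) (\<lambda>p. f (?g p)) = integral (cbox 0 1) f"
    unfolding box_image_prod by (simp add: integral_unique)
  moreover have c: "continuous_on (cbox (0, 0) (1, 1)) (\<lambda>p. f (?g p))"
    using cg by (intro continuous_on_compose2[OF f]) auto
  ultimately show *: "integral (cbox 0 1) f = integral (cbox 0 1) (\<lambda>a. integral (cbox 0 1) (\<lambda>b. f (vector [a, b])))"
    using integral_prod_continuous[OF c] by simp
  show "integral (cbox 0 1) f = integral (cbox 0 1) (\<lambda>b. integral (cbox 0 1) (\<lambda>a. f (vector [a, b])))"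
    unfolding * using c by (intro integral_swap_continuous) (simp add: case_prod_beta)
qed

text \<open>Stokes' theorem on the torus: iterated integration, with the variable of differentiation inside,
turns the inner integral into a difference of two equal values.\<close>

lemma integral_partial_deriv_periodic:
  fixes g :: "real ^ 2 \<Rightarrow> real"
  assumes g: "C_k 1 g" and per: "\<And>t. g (t + axis i 1) = g t"
  shows "integral (cbox 0 1) (partial_deriv i g) = 0"
proof -
  have line: "integral {0..1} (\<lambda>s. partial_deriv i g (t + s *\<^sub>R axis i 1)) = 0" for t
  proof -
    have "((\<lambda>s. partial_deriv i g (t + s *\<^sub>R axis i 1)) has_integral
        (g (t + 1 *\<^sub>R axis i 1) - g (t + 0 *\<^sub>R axis i 1))) {0..1}"
      by (rule fundamental_theorem_of_calculus)
        (auto intro: has_vector_derivative_at_within[OF partial_deriv_along_line[OF g]])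
    then show ?thesis using per[of t] by (simp add: integral_unique)
  qed
  consider "i = 1" | "i = 2" using exhaust_2 by blast
  then show ?thesis
  proof cases
    case 1
    have *: "vector [a, b] = (vector [0, b] :: real ^ 2) + a *\<^sub>R axis i 1" for a b
      unfolding 1 by (simp add: vec_eq_iff forall_2 axis_def)
    have "integral (cbox 0 1) (\<lambda>a. partial_deriv i g (vector [a, b])) = 0" for b
      using line[of "vector [0, b]", folded *] by simp
    then show ?thesis
      unfolding integral_unit_square(2)[OF continuous_on_partial_deriv[OF g]] by simp
  next
    case 2
    have *: "vector [a, b] = (vector [a, 0] :: real ^ 2) + b *\<^sub>R axis i 1" for a b
      unfolding 2 by (simp add: vec_eq_iff forall_2 axis_def)
    have "integral (cbox 0 1) (\<lambda>b. partial_deriv i g (vector [a, b])) = 0" for a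
      using line[of "vector [a, 0]", folded *] by simp
    then show ?thesis
      unfolding integral_unit_square(1)[OF continuous_on_partial_deriv[OF g]] by simp
  qed
qed

lemma integral_unit_square_pos:
  fixes f :: "real ^ 2 \<Rightarrow> real"
  assumes f: "continuous_on UNIV f" and nonneg: "\<And>t. 0 \<le> f t" and t: "t \<in> cbox 0 1" "0 < f t"
  shows "0 < integral (cbox 0 1) f"
proof -
  have i: "f integrable_on cbox 0 1"
    by (intro integrable_continuous continuous_on_subset[OF f]) auto
  have "0 \<le> integral (cbox 0 1) f" by (rule integral_nonneg[OF i]) (use nonneg in auto)
  moreover have "integral (cbox 0 1) f \<noteq> 0"
  proof
    assume "integral (cbox 0 1) f = 0"
    then have "(f has_integral 0) (cbox 0 1)" using i by (simp add: has_integral_iff)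
    moreover have "box 0 (1 :: real ^ 2) \<noteq> {}" by (simp add: interval_ne_empty_cart)
    ultimately have "f t = 0"
      by (intro has_integral_0_cbox_imp_0[of 0 1 f t] continuous_on_subset[OF f]) (use nonneg t in auto)
    then show False using t by simp
  qed
  ultimately show ?thesis by simp
qed

section \<open>Mean curvature in the left-invariant frame\<close>

lemma matrix_inv_unique:
  fixes A B :: "'a::semiring_1 ^ 'n ^ 'n"
  assumes "A ** B = mat 1" "B ** A = mat 1"
  shows "matrix_inv A = B"
proof -
  have "A ** matrix_inv A = mat 1 \<and> matrix_inv A ** A = mat 1"
    unfolding matrix_inv_def by (rule someI) (use assms in blast)
  then have "matrix_inv A = matrix_inv A ** (A ** B)" "matrix_inv A ** A = mat 1"
    using assms by simp_all
  then show ?thesis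
    by (metis matrix_mul_assoc matrix_mul_lid)
qed

lemma matrix_inv_2:
  fixes A :: "real ^ 2 ^ 2"
  assumes "det A \<noteq> 0"
  shows "matrix_inv A = (1 / det A) *\<^sub>R
    vector [vector [A $ 2 $ 2, - A $ 1 $ 2], vector [- A $ 2 $ 1, A $ 1 $ 1]]"
proof -
  define d where "d = det A"
  have "d \<noteq> 0" "d = A $ 1 $ 1 * A $ 2 $ 2 - A $ 1 $ 2 * A $ 2 $ 1" using assms by (simp_all add: d_def det_2)
  then show ?thesis
    unfolding d_def[symmetric]
    by (intro matrix_inv_unique)
      (simp_all add: vec_eq_iff forall_2 matrix_matrix_mult_def mat_def sum_2 divide_simps mult.commute)
qed

lemma eigenvalues_2:
  fixes A :: "real ^ 2 ^ 2"
  shows "(\<exists>v. v \<noteq> 0 \<and> A *v v = k *s v) \<longleftrightarrow>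
    (A $ 1 $ 1 - k) * (A $ 2 $ 2 - k) = A $ 1 $ 2 * A $ 2 $ 1"
proof
  assume "\<exists>v. v \<noteq> 0 \<and> A *v v = k *s v"
  then obtain v where v: "v \<noteq> 0" "A *v v = k *s v" by blast
  have e: "A $ 1 $ 1 * v $ 1 + A $ 1 $ 2 * v $ 2 = k * v $ 1" "A $ 2 $ 1 * v $ 1 + A $ 2 $ 2 * v $ 2 = k * v $ 2"
    using v(2) by (simp_all add: vec_eq_iff forall_2 matrix_vector_mult_def sum_2)
  have "((A $ 1 $ 1 - k) * (A $ 2 $ 2 - k) - A $ 1 $ 2 * A $ 2 $ 1) * v $ 1 = 0"
    "((A $ 1 $ 1 - k) * (A $ 2 $ 2 - k) - A $ 1 $ 2 * A $ 2 $ 1) * v $ 2 = 0"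
    using e by algebra+
  moreover have "v $ 1 \<noteq> 0 \<or> v $ 2 \<noteq> 0" using v(1) by (auto simp: vec_eq_iff forall_2)
  ultimately show "(A $ 1 $ 1 - k) * (A $ 2 $ 2 - k) = A $ 1 $ 2 * A $ 2 $ 1" by auto
next
  assume d: "(A $ 1 $ 1 - k) * (A $ 2 $ 2 - k) = A $ 1 $ 2 * A $ 2 $ 1"
  have *: "\<exists>v. v \<noteq> 0 \<and> A *v v = k *s v"
    if "a \<noteq> 0 \<or> b \<noteq> 0" "A $ 1 $ 1 * a + A $ 1 $ 2 * b = k * a" "A $ 2 $ 1 * a + A $ 2 $ 2 * b = k * b" for a b
    using that by (intro exI[of _ "vector [a, b]"])
      (auto simp: vec_eq_iff forall_2 matrix_vector_mult_def sum_2)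
  consider "A $ 1 $ 2 \<noteq> 0 \<or> k \<noteq> A $ 1 $ 1" | "A $ 2 $ 1 \<noteq> 0 \<or> k \<noteq> A $ 2 $ 2"
    | "A $ 1 $ 2 = 0" "k = A $ 1 $ 1" "A $ 2 $ 1 = 0" by blast
  then show "\<exists>v. v \<noteq> 0 \<and> A *v v = k *s v"
  proof cases
    case 1
    then show ?thesis using d by (intro *[of "A $ 1 $ 2" "k - A $ 1 $ 1"]) (auto simp: algebra_simps)
  next
    case 2
    then show ?thesis using d by (intro *[of "k - A $ 2 $ 2" "A $ 2 $ 1"]) (auto simp: algebra_simps)
  next
    case 3
    then show ?thesis by (intro *[of 1 0]) auto
  qed
qed

lemma Min_plus_Max_eigenvalues_2:
  fixes A :: "real ^ 2 ^ 2"
  assumes disc: "0 \<le> (A $ 1 $ 1 - A $ 2 $ 2)\<^sup>2 + 4 * A $ 1 $ 2 * A $ 2 $ 1"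
  defines "E \<equiv> {k. \<exists>v. v \<noteq> 0 \<and> A *v v = k *s v}"
  shows "Min E + Max E = A $ 1 $ 1 + A $ 2 $ 2"
proof -
  define r where "r = sqrt ((A $ 1 $ 1 - A $ 2 $ 2)\<^sup>2 + 4 * A $ 1 $ 2 * A $ 2 $ 1)"
  have r: "r * r = (A $ 1 $ 1 - A $ 2 $ 2)\<^sup>2 + 4 * A $ 1 $ 2 * A $ 2 $ 1" "0 \<le> r"
    using disc by (simp_all add: r_def)
  let ?tr = "A $ 1 $ 1 + A $ 2 $ 2"
  have "k \<in> E \<longleftrightarrow> k = (?tr - r) / 2 \<or> k = (?tr + r) / 2" for k
  proof -
    have "k \<in> E \<longleftrightarrow> (2 * k - ?tr - r) * (2 * k - ?tr + r) = 0"
      unfolding E_def mem_Collect_eq eigenvalues_2 using r(1) by algebra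
    then show ?thesis by auto
  qed
  then have "E = {(?tr - r) / 2, (?tr + r) / 2}" by blast
  then show ?thesis using r(2) by (simp add: min_def max_def field_simps)
qed

text \<open>Half the sum of the smallest and the largest eigenvalue is half the trace because both eigenvalues
are real; the reason is that the shape operator is self-adjoint.\<close>

lemma mean_curvature_eq_trace:
  assumes B: "second_ff F n t $ 1 $ 2 = second_ff F n t $ 2 $ 1"
    and G: "0 < first_ff F t $ 1 $ 1" "0 < det (first_ff F t)"
  shows "mean_curvature F n t =
    (first_ff F t $ 2 $ 2 * second_ff F n t $ 1 $ 1 - 2 * first_ff F t $ 1 $ 2 * second_ff F n t $ 1 $ 2
      + first_ff F t $ 1 $ 1 * second_ff F n t $ 2 $ 2) / (2 * det (first_ff F t))"
proof -
  let ?G = "first_ff F t" and ?B = "second_ff F n t" and ?A = "shape_operator F n t"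
  have sym: "?G $ 2 $ 1 = ?G $ 1 $ 2"
    by (simp add: first_ff_def nil_metric_def algebra_simps)
  define g where "g = det ?G"
  have g: "g = ?G $ 1 $ 1 * ?G $ 2 $ 2 - ?G $ 1 $ 2 * ?G $ 1 $ 2" "0 < g"
    using G by (simp_all add: g_def det_2 sym)
  have A: "g * ?A $ 1 $ 1 = ?G $ 2 $ 2 * ?B $ 1 $ 1 - ?G $ 1 $ 2 * ?B $ 1 $ 2"
    "g * ?A $ 1 $ 2 = ?G $ 2 $ 2 * ?B $ 1 $ 2 - ?G $ 1 $ 2 * ?B $ 2 $ 2"
    "g * ?A $ 2 $ 1 = ?G $ 1 $ 1 * ?B $ 1 $ 2 - ?G $ 1 $ 2 * ?B $ 1 $ 1"
    "g * ?A $ 2 $ 2 = ?G $ 1 $ 1 * ?B $ 2 $ 2 - ?G $ 1 $ 2 * ?B $ 1 $ 2"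
    using g(2) G(2) unfolding g_def
    by (simp_all add: shape_operator_def matrix_inv_2 matrix_matrix_mult_def sum_2 sym B[symmetric] field_simps)
  \<comment> \<open>The shape operator is self-adjoint for the first fundamental form, so that the discriminant of
    its characteristic polynomial is a value of this positive definite form.\<close>
  have "?G $ 1 $ 1 * (g * g * ((?A $ 1 $ 1 - ?A $ 2 $ 2)\<^sup>2 + 4 * ?A $ 1 $ 2 * ?A $ 2 $ 1)) =
      ?G $ 1 $ 1 * (g * ?A $ 1 $ 1 - g * ?A $ 2 $ 2)\<^sup>2 + 2 * ?G $ 1 $ 2 * (g * ?A $ 1 $ 1 - g * ?A $ 2 $ 2) * (2 * (g * ?A $ 2 $ 1))
       + ?G $ 2 $ 2 * (2 * (g * ?A $ 2 $ 1))\<^sup>2"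
  proof -
    have "?G $ 1 $ 1 * (g * ?A $ 1 $ 2) = ?G $ 1 $ 2 * (g * ?A $ 1 $ 1 - g * ?A $ 2 $ 2) + ?G $ 2 $ 2 * (g * ?A $ 2 $ 1)"
      unfolding A by algebra
    then show ?thesis by algebra
  qed
  moreover have "0 \<le> ?G $ 1 $ 1 * (?G $ 1 $ 1 * a\<^sup>2 + 2 * ?G $ 1 $ 2 * a * b + ?G $ 2 $ 2 * b\<^sup>2)" for a b
  proof -
    have "?G $ 1 $ 1 * (?G $ 1 $ 1 * a\<^sup>2 + 2 * ?G $ 1 $ 2 * a * b + ?G $ 2 $ 2 * b\<^sup>2) = (?G $ 1 $ 1 * a + ?G $ 1 $ 2 * b)\<^sup>2 + g * b\<^sup>2"
      unfolding g(1) by algebra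
    then show ?thesis using g(2) by simp
  qed
  ultimately have "0 \<le> ?G $ 1 $ 1 * (?G $ 1 $ 1 * (g * g * ((?A $ 1 $ 1 - ?A $ 2 $ 2)\<^sup>2 + 4 * ?A $ 1 $ 2 * ?A $ 2 $ 1)))"
    by metis
  then have "(?G $ 1 $ 1 * ?G $ 1 $ 1 * (g * g)) * 0 \<le>
      (?G $ 1 $ 1 * ?G $ 1 $ 1 * (g * g)) * ((?A $ 1 $ 1 - ?A $ 2 $ 2)\<^sup>2 + 4 * ?A $ 1 $ 2 * ?A $ 2 $ 1)"
    by (simp only: mult.assoc mult_zero_right)
  moreover have "0 < ?G $ 1 $ 1 * ?G $ 1 $ 1 * (g * g)"
    using G(1) g(2) by simp
  ultimately have "0 \<le> (?A $ 1 $ 1 - ?A $ 2 $ 2)\<^sup>2 + 4 * ?A $ 1 $ 2 * ?A $ 2 $ 1"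
    using mult_le_cancel_left_pos by blast
  from Min_plus_Max_eigenvalues_2[OF this]
  have "2 * g * mean_curvature F n t = g * ?A $ 1 $ 1 + g * ?A $ 2 $ 2"
    unfolding mean_curvature_def principal_curvatures_def by (simp add: algebra_simps)
  then have "2 * g * mean_curvature F n t = ?G $ 2 $ 2 * ?B $ 1 $ 1 - 2 * ?G $ 1 $ 2 * ?B $ 1 $ 2 + ?G $ 1 $ 1 * ?B $ 2 $ 2"
    unfolding A by simp
  then show ?thesis using g(2) unfolding g_def[symmetric] by (simp add: field_simps)
qed

text \<open>The components of a tangent vector at \<open>p\<close> in the left-invariant orthonormal frame. In these
components the metric is the Euclidean inner product, at every point, and the cross product of
\<^typ>\<open>real ^ 3\<close> produces normal vectors and areas.\<close>

definition frame_coords :: "nil \<Rightarrow> real ^ 3 \<Rightarrow> real ^ 3" where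
  "frame_coords p v = vector [v $ 1, v $ 2, v $ 3 - p $ 1 * v $ 2]"

lemma nil_metric_frame_coords: "nil_metric p u v = frame_coords p u \<bullet> frame_coords p v"
  by (simp add: nil_metric_def frame_coords_def inner_vec_def sum_3)

lemma nil_gram_eq:
  "nil_gram p = vector [vector [1, 0, 0], vector [0, 1 + (p $ 1)\<^sup>2, - p $ 1], vector [0, - p $ 1, 1]]"
  by (simp add: nil_gram_def vec_eq_iff forall_3 nil_metric_def axis_def power2_eq_square)

lemma matrix_inv_nil_gram:
  "matrix_inv (nil_gram p) = vector [vector [1, 0, 0], vector [0, 1, p $ 1], vector [0, p $ 1, 1 + (p $ 1)\<^sup>2]]"
  by (rule matrix_inv_unique)
    (simp_all add: nil_gram_eq vec_eq_iff forall_3 matrix_matrix_mult_def mat_def sum_3 power2_eq_square algebra_simps)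

lemma partial_deriv_nil_gram:
  "partial_deriv i (\<lambda>q. nil_gram q $ j $ k) p =
    (if i = 1 then vector [vector [0, 0, 0], vector [0, 2 * p $ 1, - 1], vector [0, - 1, 0]] $ j $ k else (0::real))"
proof -
  have d: "((\<lambda>q::nil. q $ 1) has_derivative (\<lambda>v. v $ 1)) (at p)"
    by (rule bounded_linear_imp_has_derivative[OF bounded_linear_vec_nth])
  have p: "partial_deriv i f p = f' (axis i 1)" if "(f has_derivative f') (at p)" for f f' i
    using that unfolding partial_deriv_def by (metis frechet_derivative_at)
  have "partial_deriv i (\<lambda>q. c) p = (0::real)" for c i
    by (rule p[of "\<lambda>q. c" "\<lambda>_. 0"]) simp
  moreover have "partial_deriv i (\<lambda>q. 1 + (q $ 1)\<^sup>2) p = 2 * p $ 1 * axis i (1::real) $ 1" for i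
    by (rule p) (auto intro!: derivative_eq_intros d)
  moreover have "partial_deriv i (\<lambda>q. - q $ 1) p = - axis i (1::real) $ 1" for i
    by (rule p) (auto intro!: derivative_eq_intros d)
  ultimately have "\<forall>i j k. partial_deriv i (\<lambda>q. nil_gram q $ j $ k) p =
    (if i = 1 then vector [vector [0, 0, 0], vector [0, 2 * p $ 1, - 1], vector [0, - 1, 0]] $ j $ k else 0)"
    unfolding forall_3 nil_gram_eq by (simp add: axis_def)
  then show ?thesis by blast
qed

text \<open>The covariant derivative of the left-invariant field with components \<open>V\<close> in direction \<open>U\<close>; the
formula comes from the only nontrivial bracket \<open>[e\<^sub>1, e\<^sub>2] = e\<^sub>3\<close>.\<close>

definition frame_connection :: "real ^ 3 \<Rightarrow> real ^ 3 \<Rightarrow> real ^ 3" where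
  "frame_connection U V = vector [(U $ 2 * V $ 3 + U $ 3 * V $ 2) / 2,
     - (U $ 1 * V $ 3 + U $ 3 * V $ 1) / 2, (U $ 1 * V $ 2 - U $ 2 * V $ 1) / 2]"

text \<open>The additional term is the one that arises when the third frame component \<open>dz - x dy\<close> of a vector
field is differentiated instead of the field itself.\<close>

lemma frame_coords_christoffel:
  "frame_coords p (\<chi> k. \<Sum>a\<in>UNIV. \<Sum>b\<in>UNIV. christoffel k a b p * u $ a * v $ b) =
    frame_connection (frame_coords p u) (frame_coords p v) - (u $ 1 * v $ 2) *\<^sub>R axis 3 1"
  by (simp add: vec_eq_iff forall_3 frame_coords_def frame_connection_def christoffel_def sum_3
      matrix_inv_nil_gram partial_deriv_nil_gram axis_def power2_eq_square field_simps)

section \<open>Surfaces invariant under rotation\<close>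

text \<open>The algebraic core. At a point at distance \<open>sqrt (x\<^sup>2 + y\<^sup>2)\<close> from the axis, \<open>u\<close> is the unit normal,
\<open>P\<close> a tangent vector, \<open>m\<close> the derivative of the normal in direction \<open>P\<close>, and \<open>D\<close> the signed area
spanned by \<open>P\<close> and the rotation field; \<open>tr\<close> equals \<open>- 2 H D\<close>. Everything becomes short in the radial
and angular components of \<open>u\<close>, \<open>m\<close> and \<open>P\<close> with respect to the axis: these are \<open>R\<close>, \<open>mr\<close>, \<open>Pr\<close> and
\<open>mp\<close>, \<open>Pp\<close> in the proof, scaled by the distance so that no square root occurs.\<close>

lemma rotation_invariance_identity:
  fixes x y D :: real
  assumes unit: "u1\<^sup>2 + u2\<^sup>2 + u3\<^sup>2 = 1"
    and um: "u1 * m1 + u2 * m2 + u3 * m3 = 0"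
    and uP: "u1 * P1 + u2 * P2 + u3 * P3 = 0"
    and uK: "- y * u1 + x * u2 - (x\<^sup>2 + y\<^sup>2) / 2 * u3 = 0"
    and Km: "- y * m1 + x * m2 - (x\<^sup>2 + y\<^sup>2) / 2 * m3 = u1 * P2 - u2 * P1 + u3 * (x * P1 + y * P2)"
    and D: "D * u1 = - P2 * (x\<^sup>2 + y\<^sup>2) / 2 - P3 * x" "D * u2 = - P3 * y + P1 * (x\<^sup>2 + y\<^sup>2) / 2"
      "D * u3 = P1 * x + P2 * y"
    and tr: "tr = u1 * (- m2 * (x\<^sup>2 + y\<^sup>2) / 2 - m3 * x) + u2 * (- m3 * y + m1 * (x\<^sup>2 + y\<^sup>2) / 2)
      + u3 * (m1 * x + m2 * y) + (u1 * (- P3 * u1) + u2 * (- P3 * u2) + u3 * (P1 * u1 + P2 * u2))"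
    and nz: "x\<^sup>2 + y\<^sup>2 \<noteq> 0"
  shows "(4 + (x\<^sup>2 + y\<^sup>2)) * (x\<^sup>2 + y\<^sup>2) * m3 =
    D * (4 - (4 + 2 * (x\<^sup>2 + y\<^sup>2)) * u3\<^sup>2) - 4 * (x * u1 + y * u2) * tr"
proof -
  define s where "s = x\<^sup>2 + y\<^sup>2"
  define R where "R = x * u1 + y * u2"
  define mr where "mr = x * m1 + y * m2"
  define mp where "mp = - y * m1 + x * m2"
  define Pr where "Pr = x * P1 + y * P2"
  define Pp where "Pp = - y * P1 + x * P2"
  have s: "s \<noteq> 0" using nz by (simp add: s_def)
  have uK': "- y * u1 + x * u2 = s / 2 * u3" using uK by (simp add: s_def)
  have rot: "s * u1 = x * R - y * (s / 2 * u3)" "s * u2 = y * R + x * (s / 2 * u3)"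
    "s * m1 = x * mr - y * mp" "s * m2 = y * mr + x * mp" "s * P1 = x * Pr - y * Pp" "s * P2 = y * Pr + x * Pp"
    unfolding uK'[symmetric] by (simp_all add: s_def R_def mr_def mp_def Pr_def Pp_def power2_eq_square algebra_simps)
  have unit': "R\<^sup>2 + s\<^sup>2 * u3\<^sup>2 / 4 + s * u3\<^sup>2 = s"
  proof -
    have "R\<^sup>2 + (- y * u1 + x * u2)\<^sup>2 + s * u3\<^sup>2 = s * (u1\<^sup>2 + u2\<^sup>2 + u3\<^sup>2)"
      by (simp add: s_def R_def power2_eq_square algebra_simps)
    then show ?thesis unfolding uK' unit by (simp add: power2_eq_square mult_ac)
  qed
  have um': "R * mr + s * u3 * (mp / 2 + m3) = 0"
  proof -
    have "R * mr + (- y * u1 + x * u2) * mp + s * u3 * m3 = s * (u1 * m1 + u2 * m2 + u3 * m3)"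
      by (simp add: s_def R_def mr_def mp_def power2_eq_square algebra_simps)
    then show ?thesis unfolding uK' um by (simp add: algebra_simps)
  qed
  have Km': "s * (mp - s / 2 * m3) = R * Pp + s * u3 * Pr / 2"
  proof -
    have 1: "s * (u1 * P2 - u2 * P1) = R * Pp - s / 2 * u3 * Pr"
      unfolding uK'[symmetric]
      by (simp add: s_def R_def Pr_def Pp_def power2_eq_square algebra_simps)
    have 2: "mp - s / 2 * m3 = (u1 * P2 - u2 * P1) + u3 * Pr"
      using Km by (simp add: s_def mp_def Pr_def)
    show ?thesis unfolding 2 distrib_left 1 by (simp add: algebra_simps)
  qed
  have D3: "D * u3 = Pr" using D(3) by (simp add: Pr_def algebra_simps)
  have DR: "D * R = - s * (Pp / 2 + P3)"
  proof -
    have "D * R = x * (D * u1) + y * (D * u2)" by (simp add: R_def algebra_simps)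
    then show ?thesis unfolding D by (simp add: s_def Pp_def power2_eq_square field_simps)
  qed
  have tr': "R * tr = - s * (mp / 2 + m3) - R * P3"
  proof -
    have "u1 * (- P3 * u1) + u2 * (- P3 * u2) + u3 * (P1 * u1 + P2 * u2) =
        - P3 * (u1\<^sup>2 + u2\<^sup>2 + u3\<^sup>2) + u3 * (u1 * P1 + u2 * P2 + u3 * P3)"
      by (simp add: power2_eq_square algebra_simps)
    then have "tr = u1 * (- m2 * s / 2 - m3 * x) + u2 * (- m3 * y + m1 * s / 2) + u3 * mr - P3"
      unfolding unit uP using tr by (simp add: s_def mr_def algebra_simps)
    then have "tr = - (s * u1) * m2 / 2 + (s * u2) * m1 / 2 - R * m3 + u3 * mr - P3"
      by (simp add: R_def field_simps)
    moreover have "- (s * u1) * m2 / 2 + (s * u2) * m1 / 2 = - R * mp / 2 + s * u3 * mr / 4"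
      unfolding rot by (simp add: mr_def mp_def power2_eq_square field_simps)
    ultimately have tr_eq: "tr = - R * (mp / 2 + m3) + mr * u3 * (1 + s / 4) - P3"
      by (simp add: algebra_simps)
    have 1: "R * tr = - R\<^sup>2 * (mp / 2 + m3) + (R * mr) * u3 * (1 + s / 4) - R * P3"
      unfolding tr_eq by (simp add: power2_eq_square algebra_simps)
    have 2: "R * mr = - s * u3 * (mp / 2 + m3)" using um' by simp
    have "R * tr = - (mp / 2 + m3) * (R\<^sup>2 + s\<^sup>2 * u3\<^sup>2 / 4 + s * u3\<^sup>2) - R * P3"
      unfolding 1 2 by (simp add: power2_eq_square field_simps)
    then show ?thesis unfolding unit' by (simp add: algebra_simps)
  qed
  have "s * ((4 + s) * s * m3) = s * (D * (4 - (4 + 2 * s) * u3\<^sup>2) - 4 * (R * tr))"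
  proof -
    have "s * (D * (4 - (4 + 2 * s) * u3\<^sup>2) - 4 * (R * tr)) - s * ((4 + s) * s * m3) =
       s * (D * (4 - (4 + 2 * s) * u3\<^sup>2)) + 2 * s * (s * (mp - s / 2 * m3)) + 4 * s * R * P3"
      unfolding tr' by (simp add: power2_eq_square algebra_simps)
    also have "\<dots> = s * (D * (4 - (4 + 2 * s) * u3\<^sup>2)) + 4 * R * (s * (Pp / 2 + P3)) + s * s * u3 * Pr"
      unfolding Km' by (simp add: algebra_simps)
    also have "s * (Pp / 2 + P3) = - (D * R)" using DR by simp
    also have "s * (D * (4 - (4 + 2 * s) * u3\<^sup>2)) + 4 * R * - (D * R) + s * s * u3 * Pr =
        4 * D * (s - (R\<^sup>2 + s\<^sup>2 * u3\<^sup>2 / 4 + s * u3\<^sup>2))"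
      unfolding D3[symmetric] by (simp add: power2_eq_square algebra_simps)
    also have "\<dots> = 0" unfolding unit' by simp
    finally show ?thesis by (simp only: right_minus_eq)
  qed
  then have "(4 + s) * s * m3 = D * (4 - (4 + 2 * s) * u3\<^sup>2) - 4 * (R * tr)" using s by simp
  then show ?thesis unfolding s_def R_def by (simp add: mult.assoc)
qed

text \<open>The velocity field of the rotations around the axis, in components of the left-invariant frame.\<close>

definition rotation_gen :: "nil \<Rightarrow> real ^ 3" where
  "rotation_gen p = vector [- p $ 2, p $ 1, - ((p $ 1)\<^sup>2 + (p $ 2)\<^sup>2) / 2]"

text \<open>Along an orbit of the rotations the normal of an invariant surface turns together with \<open>e\<^sub>1\<close> and
\<open>e\<^sub>2\<close>. Infinitesimally this already follows from the tangency of the rotation field and the first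
derivatives of this condition, which are the assumptions on \<open>N1\<close> and \<open>N2\<close>: the two sides have the
same inner products with \<open>u\<close>, \<open>P\<close> and \<open>Q\<close>. The asymmetry of the derivative of the normal comes from
the bracket \<open>[e\<^sub>1, e\<^sub>2] = e\<^sub>3\<close>.\<close>

lemma normal_derivative_along_rotation:
  fixes P Q u N1 N2 :: "real ^ 3"
  assumes W: "0 < W" "P \<times> Q = W *\<^sub>R u"
    and K: "a *\<^sub>R P + b *\<^sub>R Q = rotation_gen p"
    and u: "u \<bullet> u = 1" "u \<bullet> N1 = 0" "u \<bullet> N2 = 0"
    and KN: "rotation_gen p \<bullet> N1 = - u \<bullet> vector [- P $ 2, P $ 1, - (p $ 1 * P $ 1 + p $ 2 * P $ 2)]"
      "rotation_gen p \<bullet> N2 = - u \<bullet> vector [- Q $ 2, Q $ 1, - (p $ 1 * Q $ 1 + p $ 2 * Q $ 2)]"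
    and sym: "N1 \<bullet> Q - N2 \<bullet> P = (u $ 3)\<^sup>2 * W"
  shows "a *\<^sub>R N1 + b *\<^sub>R N2 = vector [- u $ 2, u $ 1, 0]"
proof -
  define v where "v = a *\<^sub>R N1 + b *\<^sub>R N2 - vector [- u $ 2, u $ 1, 0]"
  have W3: "W * u $ 3 = P $ 1 * Q $ 2 - P $ 2 * Q $ 1"
    using arg_cong[OF W(2), of "\<lambda>v. v $ 3"] by (simp add: cross3_def)
  have K12: "a * P $ 1 + b * Q $ 1 = - p $ 2" "a * P $ 2 + b * Q $ 2 = p $ 1"
    using arg_cong[OF K, of "\<lambda>v. v $ 1"] arg_cong[OF K, of "\<lambda>v. v $ 2"] by (simp_all add: rotation_gen_def)
  have "v \<bullet> u = 0"
  proof -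
    have "v \<bullet> u = a * (u \<bullet> N1) + b * (u \<bullet> N2) - vector [- u $ 2, u $ 1, 0] \<bullet> u"
      by (simp add: v_def inner_vec_def sum_3 algebra_simps)
    then show ?thesis using u(2,3) by (simp add: inner_vec_def sum_3)
  qed
  moreover have "v \<bullet> P = 0"
  proof -
    have "(a *\<^sub>R N1 + b *\<^sub>R N2) \<bullet> P = N1 \<bullet> (a *\<^sub>R P + b *\<^sub>R Q) - b * (N1 \<bullet> Q - N2 \<bullet> P)"
      by (simp add: inner_add_left inner_add_right algebra_simps)
    also have "\<dots> = u $ 1 * P $ 2 - u $ 2 * P $ 1 + u $ 3 * (p $ 1 * P $ 1 + p $ 2 * P $ 2) - b * u $ 3 * (W * u $ 3)"
      unfolding K sym using KN(1) by (simp add: inner_commute[of N1]) (simp add: inner_vec_def sum_3 power2_eq_square algebra_simps)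
    also have "\<dots> = u $ 1 * P $ 2 - u $ 2 * P $ 1"
      unfolding W3 using K12 by algebra
    finally show ?thesis by (simp add: v_def inner_diff_left) (simp add: inner_vec_def sum_3)
  qed
  moreover have "v \<bullet> Q = 0"
  proof -
    have "(a *\<^sub>R N1 + b *\<^sub>R N2) \<bullet> Q = N2 \<bullet> (a *\<^sub>R P + b *\<^sub>R Q) + a * (N1 \<bullet> Q - N2 \<bullet> P)"
      by (simp add: inner_add_left inner_add_right algebra_simps)
    also have "\<dots> = u $ 1 * Q $ 2 - u $ 2 * Q $ 1 + u $ 3 * (p $ 1 * Q $ 1 + p $ 2 * Q $ 2) + a * u $ 3 * (W * u $ 3)"
      unfolding K sym using KN(2) by (simp add: inner_commute[of N2]) (simp add: inner_vec_def sum_3 power2_eq_square algebra_simps)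
    also have "\<dots> = u $ 1 * Q $ 2 - u $ 2 * Q $ 1"
      unfolding W3 using K12 by algebra
    finally show ?thesis by (simp add: v_def inner_diff_left) (simp add: inner_vec_def sum_3)
  qed
  moreover have "W * (v \<bullet> v) = 0" if "v \<bullet> u = 0" "v \<bullet> P = 0" "v \<bullet> Q = 0"
  proof -
    have "(P \<times> Q) \<times> v = (P \<bullet> v) *\<^sub>R Q - (Q \<bullet> v) *\<^sub>R P"
      by (simp add: vec_eq_iff forall_3 cross3_def inner_vec_def sum_3 algebra_simps)
    then have "u \<times> v = 0"
      using that W by (simp add: inner_commute cross_mult_left)
    then have "(norm u * norm v)\<^sup>2 = 0"
      using norm_cross_dot[of u v] that by (simp add: inner_commute)
    then show ?thesis using u(1) by (auto simp: norm_eq_sqrt_inner)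
  qed
  ultimately show ?thesis using W(1) by (simp add: v_def)
qed

lemma cross_rotation_gen:
  "P \<times> rotation_gen p = vector [- P $ 2 * ((p $ 1)\<^sup>2 + (p $ 2)\<^sup>2) / 2 - P $ 3 * p $ 1,
     - P $ 3 * p $ 2 + P $ 1 * ((p $ 1)\<^sup>2 + (p $ 2)\<^sup>2) / 2, P $ 1 * p $ 1 + P $ 2 * p $ 2]"
  by (simp add: cross3_def rotation_gen_def vec_eq_iff forall_3 field_simps)

text \<open>In terms of the profile curve, with angle \<open>\<sigma>\<close> and distance \<open>\<rho>\<close> from the axis, this amounts to
\<open>d(cos \<sigma>) \<and> d\<phi> = - \<sigma>' sin \<sigma> ds \<and> d\<phi>\<close>, with \<open>\<sigma>'\<close> expressed through
\<open>2 H = \<sigma>' + sin \<sigma> / \<rho>\<close>. Since the rotation field is a combination of \<open>P\<close> and \<open>Q\<close>, one of these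
can be replaced by the rotation field, along which the derivative of the normal is known.\<close>

lemma wedge_identity:
  fixes P Q u N1 N2 :: "real ^ 3"
  assumes W: "0 < W" "P \<times> Q = W *\<^sub>R u"
    and K: "a *\<^sub>R P + b *\<^sub>R Q = rotation_gen p"
    and u: "u \<bullet> u = 1" "u \<bullet> N1 = 0" "u \<bullet> N2 = 0"
    and KN: "rotation_gen p \<bullet> N1 = - u \<bullet> vector [- P $ 2, P $ 1, - (p $ 1 * P $ 1 + p $ 2 * P $ 2)]"
      "rotation_gen p \<bullet> N2 = - u \<bullet> vector [- Q $ 2, Q $ 1, - (p $ 1 * Q $ 1 + p $ 2 * Q $ 2)]"
    and sym: "N1 \<bullet> Q - N2 \<bullet> P = (u $ 3)\<^sup>2 * W"
    and off_axis: "(p $ 1)\<^sup>2 + (p $ 2)\<^sup>2 \<noteq> 0"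
  defines "s \<equiv> (p $ 1)\<^sup>2 + (p $ 2)\<^sup>2"
  shows "(4 + s) * (N1 $ 3 * (p $ 1 * Q $ 2 - p $ 2 * Q $ 1) - N2 $ 3 * (p $ 1 * P $ 2 - p $ 2 * P $ 1)) =
     W * (4 - (4 + 2 * s) * (u $ 3)\<^sup>2) - 4 * (p $ 1 * u $ 1 + p $ 2 * u $ 2) * (u \<bullet> (N1 \<times> Q + P \<times> N2))"
    (is "(4 + s) * ?L = ?R")
proof -
  let ?Z = "vector [- u $ 2, u $ 1, 0] :: real ^ 3"
  have V: "a *\<^sub>R N1 + b *\<^sub>R N2 = ?Z"
    by (rule normal_derivative_along_rotation[OF W K u KN sym])
  have V3: "a * N1 $ 3 + b * N2 $ 3 = 0" using arg_cong[OF V, of "\<lambda>v. v $ 3"] by simp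
  have K12: "a * P $ 1 + b * Q $ 1 = - p $ 2" "a * P $ 2 + b * Q $ 2 = p $ 1"
    using arg_cong[OF K, of "\<lambda>v. v $ 1"] arg_cong[OF K, of "\<lambda>v. v $ 2"] by (simp_all add: rotation_gen_def)
  have uP: "u \<bullet> P = 0" "u \<bullet> Q = 0"
    using W dot_cross_self[of P Q] dot_cross_self[of Q P] by (auto simp: inner_commute)
  then have uK: "u \<bullet> rotation_gen p = 0"
    unfolding K[symmetric] by (simp add: inner_add_right)
  have *: "(4 + s) * s * N $ 3 =
      D * (4 - (4 + 2 * s) * (u $ 3)\<^sup>2) - 4 * (p $ 1 * u $ 1 + p $ 2 * u $ 2) * (u \<bullet> (N \<times> rotation_gen p + X \<times> ?Z))"
    if "u \<bullet> N = 0" "u \<bullet> X = 0" "D *\<^sub>R u = X \<times> rotation_gen p"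
      "rotation_gen p \<bullet> N = - u \<bullet> vector [- X $ 2, X $ 1, - (p $ 1 * X $ 1 + p $ 2 * X $ 2)]" for N X D
    unfolding s_def
  proof (rule rotation_invariance_identity[of "u $ 1" "u $ 2" "u $ 3" "N $ 1" "N $ 2" "N $ 3" "X $ 1" "X $ 2" "X $ 3"])
    show "D * u $ 1 = - X $ 2 * ((p $ 1)\<^sup>2 + (p $ 2)\<^sup>2) / 2 - X $ 3 * p $ 1"
      using arg_cong[OF that(3), of "\<lambda>v. v $ 1"] unfolding cross_rotation_gen by simp
    show "D * u $ 2 = - X $ 3 * p $ 2 + X $ 1 * ((p $ 1)\<^sup>2 + (p $ 2)\<^sup>2) / 2"
      using arg_cong[OF that(3), of "\<lambda>v. v $ 2"] unfolding cross_rotation_gen by simp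
    show "D * u $ 3 = X $ 1 * p $ 1 + X $ 2 * p $ 2"
      using arg_cong[OF that(3), of "\<lambda>v. v $ 3"] unfolding cross_rotation_gen by simp
  qed (use that u(1) uK off_axis in \<open>simp_all add: inner_vec_def sum_3 rotation_gen_def power2_eq_square
      cross3_def algebra_simps add_divide_distrib diff_divide_distrib\<close>)
  have "a \<noteq> 0 \<or> b \<noteq> 0" using K off_axis by (auto simp: rotation_gen_def vec_eq_iff forall_3)
  then show ?thesis
  proof
    assume b: "b \<noteq> 0"
    have "P \<times> rotation_gen p = b *\<^sub>R (P \<times> Q)"
      unfolding K[symmetric] by (simp add: cross_add_right cross_mult_right)
    then have "(b * W) *\<^sub>R u = P \<times> rotation_gen p" using W by simp
    note I = *[OF u(2) uP(1) this KN(1)]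
    have "u \<bullet> (N1 \<times> rotation_gen p + P \<times> ?Z) = b * (u \<bullet> (N1 \<times> Q + P \<times> N2))"
    proof -
      have "N1 \<times> rotation_gen p + P \<times> ?Z = b *\<^sub>R (N1 \<times> Q + P \<times> N2) + a *\<^sub>R (N1 \<times> P + P \<times> N1)"
        unfolding K[symmetric] V[symmetric]
        by (simp add: cross_add_right cross_mult_right algebra_simps)
      also have "N1 \<times> P + P \<times> N1 = 0" using cross_skew[of N1 P] by simp
      finally show ?thesis by simp
    qed
    moreover have "b * ?L = s * N1 $ 3"
      unfolding s_def using V3 K12 by algebra
    ultimately have "b * ((4 + s) * ?L) = b * ?R" using I by algebra
    then show ?thesis using b by simp
  next
    assume a: "a \<noteq> 0"
    have "Q \<times> rotation_gen p = - a *\<^sub>R (P \<times> Q)"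
      unfolding K[symmetric] using cross_skew[of Q P] by (simp add: cross_add_right cross_mult_right)
    then have "(- a * W) *\<^sub>R u = Q \<times> rotation_gen p" using W by simp
    note I = *[OF u(3) uP(2) this KN(2)]
    have "u \<bullet> (N2 \<times> rotation_gen p + Q \<times> ?Z) = - a * (u \<bullet> (N1 \<times> Q + P \<times> N2))"
    proof -
      have "N2 \<times> rotation_gen p + Q \<times> ?Z =
          a *\<^sub>R (N2 \<times> P + Q \<times> N1) + b *\<^sub>R (N2 \<times> Q + Q \<times> N2)"
        unfolding K[symmetric] V[symmetric]
        by (simp add: cross_add_right cross_mult_right algebra_simps)
      also have "N2 \<times> Q + Q \<times> N2 = 0" using cross_skew[of N2 Q] by simp
      also have "N2 \<times> P + Q \<times> N1 = - (N1 \<times> Q + P \<times> N2)"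
        using cross_skew[of N2 P] cross_skew[of Q N1] by simp
      finally have "N2 \<times> rotation_gen p + Q \<times> ?Z = - a *\<^sub>R (N1 \<times> Q + P \<times> N2)"
        by (simp add: algebra_simps)
      then show ?thesis by (simp only: inner_scaleR_right)
    qed
    moreover have "- a * ?L = s * N2 $ 3"
      unfolding s_def using V3 K12 by algebra
    ultimately have "- a * ((4 + s) * ?L) = - a * ?R" using I by algebra
    then show ?thesis using a by simp
  qed
qed

section \<open>The unit normal and the mean curvature of a parametrised surface\<close>

definition tangent :: "(real ^ 2 \<Rightarrow> nil) \<Rightarrow> 2 \<Rightarrow> real ^ 2 \<Rightarrow> real ^ 3" where
  "tangent F i t = frame_coords (F t) (partial_deriv i F t)"

definition area_element :: "(real ^ 2 \<Rightarrow> nil) \<Rightarrow> real ^ 2 \<Rightarrow> real" where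
  "area_element F t = norm (tangent F 1 t \<times> tangent F 2 t)"

definition unit_normal :: "(real ^ 2 \<Rightarrow> nil) \<Rightarrow> real ^ 2 \<Rightarrow> real ^ 3" where
  "unit_normal F t = inverse (area_element F t) *\<^sub>R (tangent F 1 t \<times> tangent F 2 t)"

text \<open>Half the trace of the negative derivative of the frame components of the unit normal. No connection
term enters: a left-invariant field is divergence free, and its covariant derivatives are orthogonal
to it because its length is constant.\<close>

definition mean_curv :: "(real ^ 2 \<Rightarrow> nil) \<Rightarrow> real ^ 2 \<Rightarrow> real" where
  "mean_curv F t = - (unit_normal F t \<bullet> (partial_deriv 1 (unit_normal F) t \<times> tangent F 2 t +
     tangent F 1 t \<times> partial_deriv 2 (unit_normal F) t)) / (2 * area_element F t)"

lemma frame_coords_eq: "frame_coords p v = v - (p $ 1 * v $ 2) *\<^sub>R axis 3 1"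
  by (simp add: frame_coords_def vec_eq_iff forall_3 axis_def)

lemma linear_frame_coords: "linear (frame_coords p)"
  by (rule linearI) (simp_all add: frame_coords_def vec_eq_iff forall_3 algebra_simps)

lemma frame_coords_eq_0: "frame_coords p v = 0 \<longleftrightarrow> v = 0"
  by (auto simp: frame_coords_def vec_eq_iff forall_3)

locale immersion =
  fixes F :: "real ^ 2 \<Rightarrow> nil"
  assumes smooth: "smooth F"
    and inj: "\<And>t. inj (frechet_derivative F (at t))"
begin

lemma C1: "C_k 1 F" "C_k 1 (partial_deriv i F)" "C_k 1 (partial_deriv j (partial_deriv i F))"
  by (intro smooth_C_k_1 smooth_partial_deriv smooth)+

abbreviation "P i t \<equiv> tangent F i t"
abbreviation "W t \<equiv> area_element F t"
abbreviation "u t \<equiv> unit_normal F t"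
abbreviation "N i t \<equiv> partial_deriv i (unit_normal F) t"
abbreviation "H t \<equiv> mean_curv F t"

lemma C_k_1_tangent: "C_k 1 (tangent F i)"
  unfolding tangent_def[abs_def] frame_coords_eq
  by (intro C_k_1_diff C_k_1_scaleR C_k_1_mult C_k_1_nth C_k_1_const C1)

lemma partial_deriv_tangent:
  "partial_deriv j (tangent F i) t = frame_coords (F t) (partial_deriv j (partial_deriv i F) t) -
     (partial_deriv j F t $ 1 * partial_deriv i F t $ 2) *\<^sub>R axis 3 1"
proof -
  have "partial_deriv j (\<lambda>t. partial_deriv i F t - (F t $ 1 * partial_deriv i F t $ 2) *\<^sub>R axis 3 (1::real)) t =
    partial_deriv j (partial_deriv i F) t - (F t $ 1 * partial_deriv j (partial_deriv i F) t $ 2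
      + partial_deriv j F t $ 1 * partial_deriv i F t $ 2) *\<^sub>R axis 3 1"
    by (subst partial_deriv_diff partial_deriv_bilinear[OF bounded_bilinear_scaleR]
        partial_deriv_bilinear[OF bounded_bilinear_mult] partial_deriv_const partial_deriv_nth,
      (intro C_k_1_diff C_k_1_scaleR C_k_1_mult C_k_1_nth C_k_1_const C1)+)+
      (simp add: partial_deriv_const)
  then show ?thesis
    unfolding tangent_def[abs_def] frame_coords_eq by (simp add: scaleR_left_distrib)
qed

text \<open>This is \<open>[e\<^sub>1, e\<^sub>2] = e\<^sub>3\<close> pulled back to the parameter plane, that is \<open>d(dz - x dy) = - dx \<and> dy\<close>.\<close>

lemma tangent_commutator:
  "partial_deriv 1 (tangent F 2) t - partial_deriv 2 (tangent F 1) t = - ((P 1 t \<times> P 2 t) $ 3) *\<^sub>R axis 3 1"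
  unfolding partial_deriv_tangent partial_deriv_commute[OF C1(1,2), of 2 1]
  by (simp add: tangent_def frame_coords_def cross3_def vec_eq_iff forall_3 axis_def algebra_simps)

lemma tangent_independent:
  assumes "a *\<^sub>R P 1 t + b *\<^sub>R P 2 t = 0"
  shows "a = 0 \<and> b = 0"
proof -
  let ?L = "frechet_derivative F (at t)"
  have lin: "linear ?L" using has_derivative_frechet_C_k_1[OF C1(1)] has_derivative_linear by blast
  have "frame_coords (F t) (?L (a *\<^sub>R axis 1 1 + b *\<^sub>R axis 2 1)) = 0"
    using assms unfolding tangent_def partial_deriv_def
    by (simp add: linear_add[OF lin] linear_scale[OF lin] linear_add[OF linear_frame_coords] linear_scale[OF linear_frame_coords])
  then have "?L (a *\<^sub>R axis 1 1 + b *\<^sub>R axis 2 1) = ?L 0"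
    unfolding frame_coords_eq_0 by (simp add: linear_0[OF lin])
  then have "a *\<^sub>R axis 1 1 + b *\<^sub>R axis 2 1 = (0 :: real ^ 2)"
    by (rule injD[OF inj])
  then show ?thesis by (simp add: vec_eq_iff forall_2 axis_def)
qed

lemma W_pos: "0 < W t"
proof -
  have "\<not> collinear {0, P 1 t, P 2 t}"
  proof -
    have "P 1 t \<noteq> 0" "P 2 t \<noteq> 0" "P 2 t \<noteq> c *\<^sub>R P 1 t" for c
      using tangent_independent[of 1 t 0] tangent_independent[of 0 t 1] tangent_independent[of c t "- 1"] by auto
    then show ?thesis unfolding collinear_lemma by blast
  qed
  then show ?thesis by (simp add: area_element_def cross_eq_0)
qed

lemma unit_normal: "P 1 t \<times> P 2 t = W t *\<^sub>R u t"
  using W_pos[of t] by (simp add: unit_normal_def)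

lemma unit_normal_unit: "u t \<bullet> u t = 1"
proof -
  have "W t * W t = (P 1 t \<times> P 2 t) \<bullet> (P 1 t \<times> P 2 t)"
    by (simp only: area_element_def dot_square_norm power2_eq_square)
  also have "\<dots> = W t * W t * (u t \<bullet> u t)"
    unfolding unit_normal by simp
  finally show ?thesis using W_pos[of t] by simp
qed

lemma unit_normal_orth: "u t \<bullet> P i t = 0"
  using exhaust_2[of i] by (auto simp: unit_normal_def dot_cross_self)

lemma C_k_1_area: "C_k 1 (area_element F)"
proof -
  have eq: "area_element F = (\<lambda>t. sqrt ((P 1 t \<times> P 2 t) \<bullet> (P 1 t \<times> P 2 t)))"
    by (simp add: area_element_def fun_eq_iff norm_eq_sqrt_inner)
  show ?thesis
    unfolding eq
  proof (rule C_k_1_chain_real[where U = "{0<..}" and g = sqrt and g' = "\<lambda>s. inverse (sqrt s) / 2"])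
    show "C_k 1 (\<lambda>t. (P 1 t \<times> P 2 t) \<bullet> (P 1 t \<times> P 2 t))"
      by (intro C_k_1_bilinear[OF bounded_bilinear_inner] C_k_1_cross C_k_1_tangent)
    show "(P 1 t \<times> P 2 t) \<bullet> (P 1 t \<times> P 2 t) \<in> {0<..}" for t using W_pos[of t] by (simp add: area_element_def)
    show "(sqrt has_real_derivative inverse (sqrt s) / 2) (at s)" if "s \<in> {0<..}" for s
      using that DERIV_real_sqrt[of s] by simp
    show "continuous_on {0<..} (\<lambda>s. inverse (sqrt s) / 2)"
      by (intro continuous_intros) auto
  qed
qed

lemma C_k_1_unit_normal: "C_k 1 (unit_normal F)"
  unfolding unit_normal_def[abs_def]
proof (intro C_k_1_scaleR C_k_1_cross C_k_1_tangent)
  show "C_k 1 (\<lambda>t. inverse (W t))"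
  proof (rule C_k_1_chain_real[where U = "{0<..}" and g = inverse and g' = "\<lambda>s. - inverse (s ^ 2)"])
    show "C_k 1 (area_element F)" by (rule C_k_1_area)
    show "W t \<in> {0<..}" for t using W_pos[of t] by simp
    show "(inverse has_real_derivative - inverse (s ^ 2)) (at s)" if "s \<in> {0<..}" for s
      using that DERIV_inverse[of s] by (simp add: numeral_2_eq_2)
    show "continuous_on {0<..} (\<lambda>s::real. - inverse (s ^ 2))"
      by (intro continuous_intros) auto
  qed
qed

lemma continuous_on_unit_normal: "continuous_on UNIV (unit_normal F)"
  by (rule continuous_on_C_k_1[OF C_k_1_unit_normal])

lemma continuous_on_mean_curv: "continuous_on UNIV H"
proof -
  have cross: "continuous_on UNIV (\<lambda>t. f t \<times> g t)" if "continuous_on UNIV f" "continuous_on UNIV g" for f g :: "real ^ 2 \<Rightarrow> real ^ 3"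
    by (rule bounded_bilinear.continuous_on[OF bounded_bilinear_cross3 that])
  show ?thesis
    unfolding mean_curv_def[abs_def] using W_pos
    by (intro continuous_intros cross continuous_on_unit_normal continuous_on_partial_deriv[OF C_k_1_unit_normal]
        continuous_on_C_k_1[OF C_k_1_tangent] continuous_on_C_k_1[OF C_k_1_area]) (auto simp: less_imp_neq[symmetric])
qed

lemma inner_unit_normal_deriv:
  assumes "C_k 1 f" and "\<And>t. u t \<bullet> f t = c"
  shows "u t \<bullet> partial_deriv i f t + N i t \<bullet> f t = 0"
proof -
  have "u t \<bullet> partial_deriv i f t + N i t \<bullet> f t = partial_deriv i (\<lambda>t. u t \<bullet> f t) t"
    by (rule partial_deriv_bilinear[OF bounded_bilinear_inner C_k_1_unit_normal assms(1), symmetric])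
  also have "\<dots> = 0" unfolding assms(2) by (rule partial_deriv_const)
  finally show ?thesis .
qed

lemma unit_normal_deriv_orth: "u t \<bullet> N i t = 0"
  using inner_unit_normal_deriv[OF C_k_1_unit_normal unit_normal_unit, of t i] by (simp add: inner_commute)

lemma unit_normal_deriv_tangent: "N i t \<bullet> P j t = - (u t \<bullet> partial_deriv i (tangent F j) t)"
  using inner_unit_normal_deriv[OF C_k_1_tangent unit_normal_orth, of t i j] by simp

lemma unit_normal_deriv_asym: "N 1 t \<bullet> P 2 t - N 2 t \<bullet> P 1 t = (u t $ 3)\<^sup>2 * W t"
proof -
  have "N 1 t \<bullet> P 2 t - N 2 t \<bullet> P 1 t = - (u t \<bullet> (partial_deriv 1 (tangent F 2) t - partial_deriv 2 (tangent F 1) t))"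
    unfolding unit_normal_deriv_tangent by (simp add: inner_diff_right)
  also have "\<dots> = (u t $ 3)\<^sup>2 * W t"
    unfolding tangent_commutator unit_normal by (simp add: inner_axis power2_eq_square)
  finally show ?thesis .
qed

lemma first_ff_eq: "first_ff F t $ i $ j = P i t \<bullet> P j t"
  by (simp add: first_ff_def nil_metric_frame_coords tangent_def)

lemma det_first_ff: "det (first_ff F t) = (W t)\<^sup>2"
  using norm_cross_dot[of "P 1 t" "P 2 t"]
  by (simp add: area_element_def det_2 first_ff_eq power_mult_distrib power2_norm_eq_inner inner_commute power2_eq_square[of "P _ t \<bullet> _"])

lemma area_density_eq: "area_density F t = W t"
  unfolding area_density_def det_first_ff using W_pos[of t] by simp

lemma second_ff_eq:
  "second_ff F n t $ i $ j =
     frame_coords (F t) (n t) \<bullet> (partial_deriv i (tangent F j) t + frame_connection (P i t) (P j t))"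
proof -
  have "frame_coords (F t) (cov_deriv2 F i j t) =
      partial_deriv i (tangent F j) t + frame_connection (P i t) (P j t)"
    unfolding cov_deriv2_def linear_add[OF linear_frame_coords] frame_coords_christoffel
      partial_deriv_tangent tangent_def by simp
  then show ?thesis
    by (simp add: second_ff_def nil_metric_frame_coords inner_commute)
qed

text \<open>The connection has no trace over a tangent plane, for the reason given for \<open>mean_curv\<close>.\<close>

lemma frame_connection_trace:
  "(Q \<bullet> Q) * ((R \<times> Q) \<bullet> frame_connection R R) - (R \<bullet> Q) * ((R \<times> Q) \<bullet> frame_connection R Q + (R \<times> Q) \<bullet> frame_connection Q R)
    + (R \<bullet> R) * ((R \<times> Q) \<bullet> frame_connection Q Q) = 0"
proof -
  have "frame_connection X Y + frame_connection Y X =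
      vector [X $ 2 * Y $ 3 + X $ 3 * Y $ 2, - (X $ 1 * Y $ 3 + X $ 3 * Y $ 1), 0]" for X Y
    by (simp add: frame_connection_def vec_eq_iff forall_3 field_simps)
  moreover have "frame_connection X X = vector [X $ 2 * X $ 3, - (X $ 1 * X $ 3), 0]" for X
    by (simp add: frame_connection_def vec_eq_iff forall_3)
  ultimately show ?thesis
    unfolding inner_add_right[symmetric] by (simp add: cross3_def inner_vec_def sum_3 algebra_simps)
qed

lemma normal_field_cases:
  assumes n: "unit_normal_field F n"
  obtains e where "e = 1 \<or> e = - 1" "frame_coords (F t) (n t) = e *\<^sub>R u t"
proof -
  let ?m = "frame_coords (F t) (n t)"
  have "nil_metric (F t) (n t) (n t) = 1" "nil_metric (F t) (n t) (partial_deriv i F t) = 0" for i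
    using n unfolding unit_normal_field_def by blast+
  then have m: "?m \<bullet> ?m = 1" "?m \<bullet> P i t = 0" for i
    unfolding nil_metric_frame_coords tangent_def by blast+
  have "(P 1 t \<times> P 2 t) \<times> ?m = (P 1 t \<bullet> ?m) *\<^sub>R P 2 t - (P 2 t \<bullet> ?m) *\<^sub>R P 1 t"
    by (simp add: vec_eq_iff forall_3 cross3_def inner_vec_def sum_3 algebra_simps)
  then have "u t \<times> ?m = 0"
    using m(2) W_pos[of t] unfolding unit_normal by (simp add: inner_commute cross_mult_left)
  then have "(u t \<bullet> ?m)\<^sup>2 = 1"
    using norm_cross_dot[of "u t" ?m] m(1) unit_normal_unit[of t] by (simp add: power_mult_distrib power2_norm_eq_inner)
  define e where "e = u t \<bullet> ?m"
  have e: "e = 1 \<or> e = - 1" using \<open>(u t \<bullet> ?m)\<^sup>2 = 1\<close> unfolding e_def by (simp add: power2_eq_1_iff)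
  have "(?m - e *\<^sub>R u t) \<bullet> (?m - e *\<^sub>R u t) = 0"
    using m(1) unit_normal_unit[of t] e by (auto simp: e_def[symmetric] inner_diff_left inner_diff_right inner_commute)
  then have "?m = e *\<^sub>R u t" by simp
  with e show ?thesis using that by blast
qed

lemma mean_curvature_eq:
  assumes n: "unit_normal_field F n"
  shows "(mean_curvature F n t)\<^sup>2 = (H t)\<^sup>2" and "(n3 F n t)\<^sup>2 = (u t $ 3)\<^sup>2"
proof -
  from normal_field_cases[OF n] obtain e where e: "e = 1 \<or> e = - 1" and m: "frame_coords (F t) (n t) = e *\<^sub>R u t" .
  have ee: "e * e = 1" using e by auto
  have "n3 F n t = (e *\<^sub>R u t) $ 3"
    unfolding m[symmetric] n3_def nil_frame_eq nil_metric_def frame_coords_def by simp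
  then show "(n3 F n t)\<^sup>2 = (u t $ 3)\<^sup>2"
    using ee by (simp add: power_mult_distrib power2_eq_square)
  let ?d = "\<lambda>i j. u t \<bullet> partial_deriv i (tangent F j) t" and ?c = "\<lambda>i j. u t \<bullet> frame_connection (P i t) (P j t)"
  have B: "second_ff F n t $ i $ j = e * (?d i j + ?c i j)" for i j
    unfolding second_ff_eq m by (simp add: inner_add_right distrib_left)
  have sym: "second_ff F n t $ 1 $ 2 = second_ff F n t $ 2 $ 1"
  proof -
    have "u t \<bullet> (partial_deriv 1 (tangent F 2) t - partial_deriv 2 (tangent F 1) t) =
       u t \<bullet> (frame_connection (P 2 t) (P 1 t) - frame_connection (P 1 t) (P 2 t))"
      unfolding tangent_commutator
      by (rule arg_cong[where f = "\<lambda>v. u t \<bullet> v"]) (simp add: frame_connection_def cross3_def vec_eq_iff forall_3 axis_def field_simps)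
    then show ?thesis unfolding B by (simp add: inner_diff_right algebra_simps)
  qed
  have G1: "0 < first_ff F t $ 1 $ 1"
    unfolding first_ff_eq using tangent_independent[of 1 t 0] by auto
  have G2: "0 < det (first_ff F t)" unfolding det_first_ff using W_pos[of t] by simp
  have tr: "(P 2 t \<bullet> P 2 t) * ?c 1 1 - (P 1 t \<bullet> P 2 t) * (?c 1 2 + ?c 2 1) + (P 1 t \<bullet> P 1 t) * ?c 2 2 = 0"
  proof -
    have "W t * ((P 2 t \<bullet> P 2 t) * ?c 1 1 - (P 1 t \<bullet> P 2 t) * (?c 1 2 + ?c 2 1) + (P 1 t \<bullet> P 1 t) * ?c 2 2) = 0"
      using frame_connection_trace[of "P 2 t" "P 1 t"] unfolding unit_normal by (simp add: algebra_simps)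
    then show ?thesis using W_pos[of t] by simp
  qed
  have "mean_curvature F n t * (2 * (W t)\<^sup>2) = first_ff F t $ 2 $ 2 * second_ff F n t $ 1 $ 1
      - 2 * first_ff F t $ 1 $ 2 * second_ff F n t $ 1 $ 2 + first_ff F t $ 1 $ 1 * second_ff F n t $ 2 $ 2"
    unfolding mean_curvature_eq_trace[OF sym G1 G2] det_first_ff using W_pos[of t] by simp
  also have "\<dots> = (P 2 t \<bullet> P 2 t) * second_ff F n t $ 1 $ 1
      - (P 1 t \<bullet> P 2 t) * (second_ff F n t $ 1 $ 2 + second_ff F n t $ 2 $ 1)
      + (P 1 t \<bullet> P 1 t) * second_ff F n t $ 2 $ 2"
    unfolding first_ff_eq sym by simp
  also have "\<dots> = e * ((P 2 t \<bullet> P 2 t) * (?d 1 1 + ?c 1 1)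
      - (P 1 t \<bullet> P 2 t) * ((?d 1 2 + ?c 1 2) + (?d 2 1 + ?c 2 1)) + (P 1 t \<bullet> P 1 t) * (?d 2 2 + ?c 2 2))"
    unfolding B by (simp add: algebra_simps)
  also have "\<dots> = e * ((P 2 t \<bullet> P 2 t) * ?d 1 1 - (P 1 t \<bullet> P 2 t) * (?d 1 2 + ?d 2 1) + (P 1 t \<bullet> P 1 t) * ?d 2 2)"
    using tr by algebra
  also have "\<dots> = - e * (W t * (u t \<bullet> (N 1 t \<times> P 2 t + P 1 t \<times> N 2 t)))"
  proof -
    have "W t * (u t \<bullet> (N 1 t \<times> P 2 t + P 1 t \<times> N 2 t)) = (P 1 t \<times> P 2 t) \<bullet> (N 1 t \<times> P 2 t + P 1 t \<times> N 2 t)"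
      unfolding unit_normal by simp
    also have "\<dots> = (P 2 t \<bullet> P 2 t) * (N 1 t \<bullet> P 1 t) - (P 1 t \<bullet> P 2 t) * (N 1 t \<bullet> P 2 t + N 2 t \<bullet> P 1 t) + (P 1 t \<bullet> P 1 t) * (N 2 t \<bullet> P 2 t)"
      by (simp add: inner_add_right dot_cross inner_commute algebra_simps)
    finally show ?thesis unfolding unit_normal_deriv_tangent by algebra
  qed
  also have "\<dots> = e * H t * (2 * (W t)\<^sup>2)"
    unfolding mean_curv_def using W_pos[of t] by (simp add: power2_eq_square)
  finally have "mean_curvature F n t = e * H t" using W_pos[of t] by simp
  then show "(mean_curvature F n t)\<^sup>2 = (H t)\<^sup>2"
    using ee by (simp add: power_mult_distrib power2_eq_square)
qed

end

section \<open>Tangency of the rotation field\<close>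

lemma torus_parametrization_near:
  assumes F: "torus_parametrization M F" and q: "q \<in> M"
  shows "\<exists>t. F t = q \<and> (\<forall>i. \<bar>t $ i - c $ i\<bar> \<le> 1 / 2)"
proof -
  obtain r where r: "F r = q" using F q unfolding torus_parametrization_def by auto
  define t where "t = (\<chi> i. r $ i - of_int (round (r $ i - c $ i)))"
  have "F t = F r"
    using F unfolding torus_parametrization_def by (auto simp: t_def)
  moreover have "\<bar>t $ i - c $ i\<bar> \<le> 1 / 2" for i
    using of_int_round_abs_le[of "r $ i - c $ i"] by (simp add: t_def abs_minus_commute algebra_simps)
  ultimately show ?thesis using r by blast
qed

text \<open>A curve that runs in the image of an embedded torus is tangent to it. By compactness of a unit
cell the curve points have parameters converging to \<open>t\<close>, and injectivity of the differential
bounds their distance to \<open>t\<close> by the time elapsed; so the difference quotients of the curve are,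
up to an error tending to zero, in the closed set of tangent vectors.\<close>

lemma velocity_in_tangent_plane:
  assumes F: "torus_parametrization M F" and C: "C_k 1 F"
    and \<gamma>: "\<And>s. \<gamma> s \<in> M" "\<gamma> 0 = F t" "(\<gamma> has_vector_derivative v) (at 0)"
  shows "v \<in> range (frechet_derivative F (at t))"
proof -
  let ?L = "frechet_derivative F (at t)"
  have dF: "(F has_derivative ?L) (at t)" by (rule has_derivative_frechet_C_k_1[OF C])
  then have lin: "linear ?L" and blin: "bounded_linear ?L"
    by (auto intro: has_derivative_linear has_derivative_bounded_linear)
  have inj: "inj ?L" using F unfolding torus_parametrization_def by blast
  define s where "s = (\<lambda>k. inverse (real (Suc k)))"
  have s: "s \<longlonglongrightarrow> 0" "\<And>k. 0 < s k" unfolding s_def by (rule LIMSEQ_inverse_real_of_nat) simp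
  have "\<forall>k. \<exists>r. F r = \<gamma> (s k) \<and> (\<forall>i. \<bar>r $ i - t $ i\<bar> \<le> 1 / 2)"
    using torus_parametrization_near[OF F \<gamma>(1)] by blast
  from choice[OF this] obtain r where r: "\<And>k. F (r k) = \<gamma> (s k)" "\<And>k i. \<bar>r k $ i - t $ i\<bar> \<le> 1 / 2"
    by blast
  let ?B = "cbox (t - (\<chi> i. 1 / 2)) (t + (\<chi> i. 1 / 2))"
  have inB: "r k \<in> ?B" for k
  proof -
    have "t $ i - 1 / 2 \<le> r k $ i \<and> r k $ i \<le> t $ i + 1 / 2" for i
      using r(2)[of k i] by linarith
    then show ?thesis by (simp add: mem_box_cart)
  qed
  then obtain l \<sigma> where l: "l \<in> ?B" "strict_mono \<sigma>" "(r \<circ> \<sigma>) \<longlonglongrightarrow> l"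
    using compact_cbox unfolding compact_def by metis
  have s\<sigma>: "(\<lambda>k. s (\<sigma> k)) \<longlonglongrightarrow> 0"
    using LIMSEQ_subseq_LIMSEQ[OF s(1) l(2)] by (simp add: o_def)
  have r\<sigma>: "(\<lambda>k. r (\<sigma> k)) \<longlonglongrightarrow> l" using l(3) by (simp add: o_def)
  have c\<gamma>: "isCont \<gamma> 0" using has_vector_derivative_continuous[OF \<gamma>(3)] .
  \<comment> \<open>A limit of the parameters has the same image as \<open>t\<close>, and \<open>t\<close> is its only lattice translate in the cell.\<close>
  have "l = t"
  proof -
    have "(\<lambda>k. \<gamma> (s (\<sigma> k))) \<longlonglongrightarrow> \<gamma> 0" by (rule isCont_tendsto_compose[OF c\<gamma> s\<sigma>])
    moreover have "(\<lambda>k. F (r (\<sigma> k))) \<longlonglongrightarrow> F l"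
      using continuous_on_tendsto_compose[OF continuous_on_C_k_1[OF C] r\<sigma>] by simp
    ultimately have "F l = F t" unfolding r(1) \<gamma>(2) using LIMSEQ_unique by blast
    then have int: "l $ i - t $ i \<in> \<int>" for i using F unfolding torus_parametrization_def by blast
    have "l $ i - t $ i = 0" for i
    proof -
      obtain m where m: "l $ i - t $ i = of_int m" using int[of i] by (auto elim: Ints_cases)
      have "t $ i - 1 / 2 \<le> l $ i" "l $ i \<le> t $ i + 1 / 2" using l(1) by (simp_all add: mem_box_cart)
      then have "\<bar>real_of_int m\<bar> \<le> 1 / 2" using m by linarith
      then have "m = 0" by linarith
      then show ?thesis using m by simp
    qed
    then show ?thesis by (simp add: vec_eq_iff)
  qed
  define d where "d = (\<lambda>k. r (\<sigma> k) - t)"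
  define \<delta> where "\<delta> = (\<lambda>k. F (r (\<sigma> k)) - F t - ?L (d k))"
  have d0: "d \<longlonglongrightarrow> 0" unfolding d_def using r\<sigma> \<open>l = t\<close> by (simp add: LIM_zero)
  have small: "eventually (\<lambda>k. norm (\<delta> k) \<le> e * norm (d k)) sequentially" if "0 < e" for e
  proof -
    obtain \<eta> where \<eta>: "0 < \<eta>" "\<And>q. norm (q - t) < \<eta> \<Longrightarrow> norm (F q - F t - ?L (q - t)) \<le> e * norm (q - t)"
      using dF[unfolded has_derivative_at_alt] \<open>0 < e\<close> by blast
    have "eventually (\<lambda>k. norm (d k) < \<eta>) sequentially"
      using tendstoD[OF d0 \<eta>(1)] by simp
    then show ?thesis
      by eventually_elim (use \<eta>(2) in \<open>simp add: \<delta>_def d_def\<close>)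
  qed
  define q where "q = (\<lambda>k. (1 / s (\<sigma> k)) *\<^sub>R (\<gamma> (s (\<sigma> k)) - \<gamma> 0))"
  have q: "q \<longlonglongrightarrow> v"
  proof -
    have "((\<lambda>h. (1 / h) *\<^sub>R (\<gamma> h - \<gamma> 0)) \<longlongrightarrow> v) (at 0)"
    proof -
      have "(\<lambda>h. norm (\<gamma> h - \<gamma> 0 - h *\<^sub>R v) / norm h) \<midarrow>0\<rightarrow> 0"
        using \<gamma>(3) unfolding has_vector_derivative_def has_derivative_at by simp
      moreover have "norm (\<gamma> h - \<gamma> 0 - h *\<^sub>R v) / norm h = norm ((1 / h) *\<^sub>R (\<gamma> h - \<gamma> 0) - v)"
        if "h \<noteq> 0" for h
      proof -
        have "(1 / h) *\<^sub>R (\<gamma> h - \<gamma> 0) - v = (1 / h) *\<^sub>R (\<gamma> h - \<gamma> 0 - h *\<^sub>R v)"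
          using that by (simp add: scaleR_diff_right)
        then show ?thesis by (simp add: divide_inverse mult.commute)
      qed
      ultimately have "(\<lambda>h. norm ((1 / h) *\<^sub>R (\<gamma> h - \<gamma> 0) - v)) \<midarrow>0\<rightarrow> 0"
        using LIM_cong[OF refl _ refl, of 0 "\<lambda>h. norm (\<gamma> h - \<gamma> 0 - h *\<^sub>R v) / norm h"
            "\<lambda>h. norm ((1 / h) *\<^sub>R (\<gamma> h - \<gamma> 0) - v)" 0] by blast
      then show ?thesis
        by (metis (no_types) LIM_zero_cancel tendsto_norm_zero_cancel)
    qed
    moreover have "filterlim (\<lambda>k. s (\<sigma> k)) (at 0) sequentially"
      unfolding filterlim_at using s\<sigma> s(2) by (auto intro!: always_eventually dest: less_imp_neq[symmetric] simp: less_imp_neq[symmetric])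
    ultimately show ?thesis
      unfolding q_def by (rule filterlim_compose)
  qed
  obtain c where c: "0 < c" "\<And>w. c * norm w \<le> norm (?L w)"
    using linear_inj_bounded_below_pos[OF lin inj] by blast
  \<comment> \<open>The parameter displacement is of the order of \<open>s\<close>, so the remainder of the linearisation is \<open>o(s)\<close>.\<close>
  have "(\<lambda>k. (1 / s (\<sigma> k)) *\<^sub>R \<delta> k) \<longlonglongrightarrow> 0"
  proof (rule tendstoI)
    fix e :: real assume e: "0 < e"
    define B where "B = norm v + 1"
    have B: "0 < B" by (simp add: B_def add_nonneg_pos)
    define e' where "e' = min (c / 2) (e * c / (4 * B))"
    have e': "0 < e'" "e' \<le> c / 2" "e' \<le> e * c / (4 * B)" using c e B by (simp_all add: e'_def)
    have "eventually (\<lambda>k. norm (q k) < B) sequentially"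
      using order_tendstoD(2)[OF tendsto_norm[OF q], of B] by (simp add: B_def)
    then show "eventually (\<lambda>k. dist ((1 / s (\<sigma> k)) *\<^sub>R \<delta> k) 0 < e) sequentially"
      using small[OF e'(1)]
    proof eventually_elim
      case (elim k)
      let ?s = "s (\<sigma> k)"
      have sk: "0 < ?s" by (rule s(2))
      have "?L (d k) = ?s *\<^sub>R q k - \<delta> k"
        using sk by (simp add: \<delta>_def q_def r(1) \<gamma>(2))
      then have "c * norm (d k) \<le> ?s * norm (q k) + norm (\<delta> k)"
        using c(2)[of "d k"] norm_triangle_ineq4[of "?s *\<^sub>R q k" "\<delta> k"] sk by simp
      also have "norm (\<delta> k) \<le> c / 2 * norm (d k)"
        by (rule order_trans[OF elim(2) mult_right_mono[OF e'(2) norm_ge_zero]])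
      finally have "c / 2 * norm (d k) \<le> ?s * B"
        using mult_left_mono[OF less_imp_le[OF elim(1)] less_imp_le[OF sk]] by (simp add: field_simps)
      then have nd: "norm (d k) \<le> 2 * B / c * ?s" using c(1) by (simp add: field_simps)
      have "norm (\<delta> k) \<le> e * c / (4 * B) * norm (d k)"
        by (rule order_trans[OF elim(2) mult_right_mono[OF e'(3) norm_ge_zero]])
      also have "\<dots> \<le> e * c / (4 * B) * (2 * B / c * ?s)"
        using nd e c(1) B by (intro mult_left_mono) auto
      also have "\<dots> = e / 2 * ?s" using B c(1) by simp
      also have "\<dots> < e * ?s" using e sk by simp
      finally have "norm (\<delta> k) < e * ?s" .
      then show ?case using sk by (simp add: field_simps)
    qed
  qed
  with q have "(\<lambda>k. q k - (1 / s (\<sigma> k)) *\<^sub>R \<delta> k) \<longlonglongrightarrow> v - 0" by (rule tendsto_diff)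
  then have lim: "(\<lambda>k. q k - (1 / s (\<sigma> k)) *\<^sub>R \<delta> k) \<longlonglongrightarrow> v" by simp
  have range: "q k - (1 / s (\<sigma> k)) *\<^sub>R \<delta> k \<in> range ?L" for k
  proof -
    have "q k - (1 / s (\<sigma> k)) *\<^sub>R \<delta> k = ?L ((1 / s (\<sigma> k)) *\<^sub>R d k)"
      unfolding linear_scale[OF lin] by (simp add: \<delta>_def q_def r(1) \<gamma>(2) algebra_simps)
    then show ?thesis by blast
  qed
  have "closed (range ?L)"
    by (rule closed_subspace[OF linear_subspace_image[OF lin subspace_UNIV]])
  then show ?thesis
    by (rule closed_sequentially[OF _ range lim])
qed

lemma rotation_velocity_in_tangent_plane:
  assumes M: "torus_of_revolution M" and F: "torus_parametrization M F" and C: "C_k 1 F"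
  shows "vector [- F t $ 2, F t $ 1, ((F t $ 1)\<^sup>2 - (F t $ 2)\<^sup>2) / 2] \<in> range (frechet_derivative F (at t))"
proof -
  obtain S where S: "M = revolve S" using M unfolding torus_of_revolution_def by blast
  have "F t \<in> M" using F unfolding torus_parametrization_def by blast
  then obtain \<rho> \<phi> h \<theta> where p: "F t = cyl \<rho> (\<phi> + \<theta>) h" "0 \<le> \<rho>" "cyl \<rho> \<phi> h \<in> S"
    unfolding S revolve_def by blast
  define \<psi> where "\<psi> = \<phi> + \<theta>"
  define \<gamma> where "\<gamma> = (\<lambda>s. cyl \<rho> (\<psi> + s) h)"
  have "\<gamma> s \<in> M" for s
    unfolding S revolve_def \<gamma>_def \<psi>_def using p(2,3) by (auto simp: add.assoc)
  moreover have "\<gamma> 0 = F t" by (simp add: \<gamma>_def \<psi>_def p(1))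
  moreover have "(\<gamma> has_vector_derivative
      vector [- F t $ 2, F t $ 1, ((F t $ 1)\<^sup>2 - (F t $ 2)\<^sup>2) / 2]) (at 0)"
  proof -
    have \<gamma>_eq: "\<gamma> = (\<lambda>s. (\<rho> * cos (\<psi> + s)) *\<^sub>R axis 1 1 + (\<rho> * sin (\<psi> + s)) *\<^sub>R axis 2 1
        + (\<rho>\<^sup>2 / 2 * cos (\<psi> + s) * sin (\<psi> + s) + h) *\<^sub>R axis 3 1)"
      by (simp add: \<gamma>_def cyl_def fun_eq_iff vec_eq_iff forall_3 axis_def)
    have "((\<lambda>s. \<rho> * cos (\<psi> + s)) has_real_derivative - \<rho> * sin \<psi>) (at 0)"
      "((\<lambda>s. \<rho> * sin (\<psi> + s)) has_real_derivative \<rho> * cos \<psi>) (at 0)"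
      "((\<lambda>s. \<rho>\<^sup>2 / 2 * cos (\<psi> + s) * sin (\<psi> + s) + h) has_real_derivative \<rho>\<^sup>2 / 2 * ((cos \<psi>)\<^sup>2 - (sin \<psi>)\<^sup>2)) (at 0)"
      by (auto intro!: derivative_eq_intros simp: power2_eq_square field_simps)
    moreover have "((\<lambda>s. f s *\<^sub>R e) has_vector_derivative f' *\<^sub>R e) (at 0)"
      if "(f has_real_derivative f') (at 0)" for f f' and e :: "real ^ 3"
      using has_vector_derivative_scaleR[OF that has_vector_derivative_const] by simp
    ultimately have "(\<gamma> has_vector_derivative (- \<rho> * sin \<psi>) *\<^sub>R axis 1 1 + (\<rho> * cos \<psi>) *\<^sub>R axis 2 1
        + (\<rho>\<^sup>2 / 2 * ((cos \<psi>)\<^sup>2 - (sin \<psi>)\<^sup>2)) *\<^sub>R axis 3 1) (at 0)"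
      unfolding \<gamma>_eq
      by (intro has_vector_derivative_add) blast+
    moreover have "(- \<rho> * sin \<psi>) *\<^sub>R (axis 1 1 :: real ^ 3) + (\<rho> * cos \<psi>) *\<^sub>R axis 2 1
        + (\<rho>\<^sup>2 / 2 * ((cos \<psi>)\<^sup>2 - (sin \<psi>)\<^sup>2)) *\<^sub>R axis 3 1 =
        vector [- F t $ 2, F t $ 1, ((F t $ 1)\<^sup>2 - (F t $ 2)\<^sup>2) / 2]"
      by (simp add: p(1) cyl_def vec_eq_iff forall_3 axis_def \<psi>_def power_mult_distrib field_simps)
    ultimately show ?thesis by simp
  qed
  ultimately show ?thesis by (intro velocity_in_tangent_plane[OF F C]) auto
qed

section \<open>The energy as the integral of a nonnegative density\<close>

text \<open>Here \<open>S = sqrt (4 + \<rho>\<^sup>2)\<close> and \<open>s = \<rho>\<^sup>2\<close>; the second summand of \<open>D\<close> is one eighth of the exterior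
derivative of the form \<open>\<omega>\<close> introduced below, and \<open>R\<close> is \<open>\<rho>\<close> times the radial component of the
unit normal. Completing the square gives
\<open>\<rho>\<^sup>2 S (S + 2) D = W ((\<rho>\<^sup>2 H + R)\<^sup>2 + \<rho>\<^sup>2 (2 S + 4) H\<^sup>2)\<close>.\<close>

lemma energy_density_off_axis:
  fixes S :: real
  assumes S: "2 \<le> S" "s = S\<^sup>2 - 4" and s: "0 < s" and W: "0 < W"
    and R: "R\<^sup>2 = s * (1 - u3\<^sup>2 * S\<^sup>2 / 4)"
    and L: "(4 + s) * L = W * (4 - (4 + 2 * s) * u3\<^sup>2) + 8 * H * W * R"
  defines "D \<equiv> (H\<^sup>2 - u3\<^sup>2 / 4) * W +
    (2 * S / (S + 2) * (L + 2 * (u3\<^sup>2 * W)) + 2 / (S * (S + 2)\<^sup>2) * (2 * s * (u3\<^sup>2 * W))) / 8"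
  shows "0 \<le> D" and "R \<noteq> 0 \<Longrightarrow> 0 < D"
proof -
  have S0: "0 < S" "S \<noteq> 0" "S + 2 \<noteq> 0" using S(1) by auto
  have L': "L = W * (4 - (2 * S\<^sup>2 - 4) * u3\<^sup>2 + 8 * H * R) / S\<^sup>2"
    using L S0 unfolding S(2) by (simp add: field_simps)
  have D: "S * (S + 2) * D = W * (S * (S + 2) * H\<^sup>2 + 2 * H * R + (1 - u3\<^sup>2 * S\<^sup>2 / 4))"
  proof -
    have 1: "S * (S + 2) * (2 * S / (S + 2) * (L + 2 * (u3\<^sup>2 * W))) = 2 * (S\<^sup>2 * L) + 4 * S\<^sup>2 * u3\<^sup>2 * W"
      using S0 by (simp add: field_simps power2_eq_square)
    have 2: "S\<^sup>2 * L = W * (4 - (2 * S\<^sup>2 - 4) * u3\<^sup>2 + 8 * H * R)"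
      unfolding L' using S0 by simp
    have 3: "S * (S + 2) * (2 / (S * (S + 2)\<^sup>2) * (2 * s * (u3\<^sup>2 * W))) = 4 * (S - 2) * (u3\<^sup>2 * W)"
    proof -
      have "s = (S + 2) * (S - 2)" unfolding S(2) by algebra
      then show ?thesis using S0 by (simp add: power2_eq_square)
    qed
    have 4: "S * (S + 2) * D = S * (S + 2) * (H\<^sup>2 - u3\<^sup>2 / 4) * W +
       (S * (S + 2) * (2 * S / (S + 2) * (L + 2 * (u3\<^sup>2 * W))) +
        S * (S + 2) * (2 / (S * (S + 2)\<^sup>2) * (2 * s * (u3\<^sup>2 * W)))) / 8"
      unfolding D_def by (simp only: distrib_left mult.assoc times_divide_eq_right)
    show ?thesis
      unfolding 4 1 2 3 by (simp add: power2_eq_square field_simps)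
  qed
  have "s * (S * (S + 2) * D) = W * ((s * H + R)\<^sup>2 + s * (2 * S + 4) * H\<^sup>2)"
  proof -
    have 1: "s * (S * (S + 2) * D) = W * (s * (S * (S + 2)) * H\<^sup>2 + 2 * s * H * R + R\<^sup>2)"
      unfolding D R by (simp add: algebra_simps)
    have 2: "S * (S + 2) = s + (2 * S + 4)" unfolding S(2) by algebra
    show ?thesis unfolding 1 unfolding 2 by (simp add: power2_eq_square algebra_simps)
  qed
  moreover have "0 \<le> (s * H + R)\<^sup>2 + s * (2 * S + 4) * H\<^sup>2" using s S0 by simp
  moreover have "0 < (s * H + R)\<^sup>2 + s * (2 * S + 4) * H\<^sup>2" if "R \<noteq> 0"
  proof (cases "H = 0")
    case True
    then show ?thesis using that by simp
  next
    case False
    then have "0 < s * (2 * S + 4) * H\<^sup>2" using s S0 by simp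
    then show ?thesis by (simp add: add_nonneg_pos)
  qed
  moreover have "0 < s * (S * (S + 2))" using s S0 by simp
  moreover have "s * (S * (S + 2) * D) = s * (S * (S + 2)) * D" by simp
  ultimately show "0 \<le> D" "R \<noteq> 0 \<Longrightarrow> 0 < D"
    using W by (metis zero_le_mult_iff less_imp_le not_less, metis zero_less_mult_pos mult_pos_pos)
qed

text \<open>The invariance under rotation enters only in infinitesimal form: the velocity field of the
rotations is tangent to the surface.\<close>

locale torus_immersion = immersion +
  assumes periodic: "\<And>t i. F (t + axis i 1) = F t"
    and rotation_tangent: "\<And>t. \<exists>a b. a *\<^sub>R tangent F 1 t + b *\<^sub>R tangent F 2 t = rotation_gen (F t)"
begin

text \<open>The form \<open>\<omega>\<close> is \<open>4 (S - 2) cos \<sigma> d\<phi>\<close>, since \<open>cos \<sigma> = n\<^sub>3 S / 2\<close>, \<open>\<rho>\<^sup>2 = (S - 2) (S + 2)\<close> and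
\<open>\<rho>\<^sup>2 d\<phi> = x dy - y dx\<close>. Written without \<open>d\<phi>\<close> it is continuously differentiable also where the
surface meets the axis.\<close>

definition sq_radius :: "real ^ 2 \<Rightarrow> real" where
  "sq_radius t = F t $ 1 * F t $ 1 + F t $ 2 * F t $ 2"

definition winding_form :: "2 \<Rightarrow> real ^ 2 \<Rightarrow> real" where
  "winding_form i t = F t $ 1 * partial_deriv i F t $ 2 - F t $ 2 * partial_deriv i F t $ 1"

definition weight :: "real \<Rightarrow> real" where
  "weight s = 2 * sqrt (4 + s) / (sqrt (4 + s) + 2)"

definition \<omega> :: "2 \<Rightarrow> real ^ 2 \<Rightarrow> real" where
  "\<omega> i t = weight (sq_radius t) * (unit_normal F t $ 3 * winding_form i t)"

lemma C_k_1_sq_radius: "C_k 1 sq_radius"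
  unfolding sq_radius_def[abs_def] by (intro C_k_1_add C_k_1_mult C_k_1_nth C1)

lemma partial_deriv_sq_radius:
  "partial_deriv j sq_radius t = 2 * (F t $ 1 * partial_deriv j F t $ 1 + F t $ 2 * partial_deriv j F t $ 2)"
proof -
  have "partial_deriv j (\<lambda>t. F t $ 1 * F t $ 1 + F t $ 2 * F t $ 2) t =
      (F t $ 1 * partial_deriv j F t $ 1 + partial_deriv j F t $ 1 * F t $ 1) +
      (F t $ 2 * partial_deriv j F t $ 2 + partial_deriv j F t $ 2 * F t $ 2)"
    by (subst partial_deriv_add partial_deriv_bilinear[OF bounded_bilinear_mult] partial_deriv_nth,
      (intro C_k_1_mult C_k_1_nth C1)+)+ simp
  then show ?thesis unfolding sq_radius_def[abs_def] by simp
qed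

lemma sq_radius_nonneg: "0 \<le> sq_radius t"
  by (simp add: sq_radius_def)

lemma C_k_1_winding_form: "C_k 1 (winding_form i)"
  unfolding winding_form_def[abs_def] by (intro C_k_1_diff C_k_1_mult C_k_1_nth C1)

lemma partial_deriv_winding_form:
  "partial_deriv j (winding_form i) t =
    (F t $ 1 * partial_deriv j (partial_deriv i F) t $ 2 + partial_deriv j F t $ 1 * partial_deriv i F t $ 2) -
    (F t $ 2 * partial_deriv j (partial_deriv i F) t $ 1 + partial_deriv j F t $ 2 * partial_deriv i F t $ 1)"
  unfolding winding_form_def[abs_def]
  by (subst partial_deriv_diff partial_deriv_bilinear[OF bounded_bilinear_mult] partial_deriv_nth,
    (intro C_k_1_mult C_k_1_nth C1)+)+ simp

lemma DERIV_weight: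
  assumes "0 \<le> s"
  shows "(weight has_real_derivative 2 / (sqrt (4 + s) * (sqrt (4 + s) + 2)\<^sup>2)) (at s)"
proof -
  have S: "0 < sqrt (4 + s)" using assms by simp
  then have nz: "sqrt (4 + s) + 2 \<noteq> 0" by linarith
  have d: "((\<lambda>s. sqrt (4 + s)) has_real_derivative inverse (sqrt (4 + s)) / 2 * (0 + 1)) (at s)"
    by (rule DERIV_chain2[OF DERIV_real_sqrt DERIV_add[OF DERIV_const DERIV_ident]]) (use assms in simp)
  note DERIV_divide[OF DERIV_cmult[OF d, of 2] DERIV_add[OF d DERIV_const[of 2]] nz]
  moreover have "(2 * (inverse r / 2 * (0 + 1)) * (r + 2) - 2 * r * (inverse r / 2 * (0 + 1) + 0)) / ((r + 2) * (r + 2)) = 2 / (r * (r + 2)\<^sup>2)"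
    if "0 < r" for r :: real
  proof -
    have "2 * (inverse r / 2 * (0 + 1)) * (r + 2) - 2 * r * (inverse r / 2 * (0 + 1) + 0) = 2 / r"
      using that by (simp add: field_simps)
    then show ?thesis by (simp add: power2_eq_square)
  qed
  ultimately show ?thesis using S unfolding weight_def[abs_def] by simp
qed

lemma C_k_1_weight: "C_k 1 (\<lambda>t. weight (sq_radius t))"
proof (rule C_k_1_chain_real[where U = "{0..}" and g = weight and g' = "\<lambda>s. 2 / (sqrt (4 + s) * (sqrt (4 + s) + 2)\<^sup>2)"])
  have "sqrt (4 + s) \<noteq> 0 \<and> sqrt (4 + s) + 2 \<noteq> 0" if "0 \<le> s" for s :: real
  proof -
    have "0 < sqrt (4 + s)" using that by simp
    then show ?thesis by linarith
  qed
  then show "continuous_on {0..} (\<lambda>s::real. 2 / (sqrt (4 + s) * (sqrt (4 + s) + 2)\<^sup>2))"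
    by (intro continuous_intros) auto
qed (use C_k_1_sq_radius sq_radius_nonneg DERIV_weight in auto)

lemma C_k_1_\<omega>: "C_k 1 (\<omega> i)"
  unfolding \<omega>_def[abs_def]
  by (intro C_k_1_mult C_k_1_weight C_k_1_winding_form C_k_1_nth C_k_1_unit_normal)

lemma partial_deriv_\<omega>:
  "partial_deriv j (\<omega> i) t = weight (sq_radius t) *
      (u t $ 3 * partial_deriv j (winding_form i) t + N j t $ 3 * winding_form i t) +
     2 / (sqrt (4 + sq_radius t) * (sqrt (4 + sq_radius t) + 2)\<^sup>2) * partial_deriv j sq_radius t
       * (u t $ 3 * winding_form i t)"
proof -
  note w = partial_deriv_chain_real[of sq_radius weight "\<lambda>s. 2 / (sqrt (4 + s) * (sqrt (4 + s) + 2)\<^sup>2)" t j,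
      OF C_k_1_sq_radius DERIV_weight[OF sq_radius_nonneg]]
  have n: "partial_deriv j (\<lambda>t. u t $ 3 * winding_form i t) t =
      u t $ 3 * partial_deriv j (winding_form i) t + N j t $ 3 * winding_form i t"
    by (subst partial_deriv_bilinear[OF bounded_bilinear_mult C_k_1_nth[OF C_k_1_unit_normal] C_k_1_winding_form])
      (simp only: partial_deriv_nth[OF C_k_1_unit_normal])
  show ?thesis
    unfolding \<omega>_def[abs_def]
    by (subst partial_deriv_bilinear[OF bounded_bilinear_mult C_k_1_weight
          C_k_1_mult[OF C_k_1_nth[OF C_k_1_unit_normal] C_k_1_winding_form]])
      (simp only: n w)
qed

lemma jacobian_eq: "partial_deriv 1 F t $ 1 * partial_deriv 2 F t $ 2 - partial_deriv 1 F t $ 2 * partial_deriv 2 F t $ 1 = u t $ 3 * W t"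
  using arg_cong[OF unit_normal[of t], of "\<lambda>v. v $ 3"]
  by (simp add: cross3_def tangent_def frame_coords_def mult.commute)

lemma exterior_derivative_\<omega>:
  "partial_deriv 1 (\<omega> 2) t - partial_deriv 2 (\<omega> 1) t =
    weight (sq_radius t) * ((N 1 t $ 3 * winding_form 2 t - N 2 t $ 3 * winding_form 1 t) + 2 * ((u t $ 3)\<^sup>2 * W t)) +
    2 / (sqrt (4 + sq_radius t) * (sqrt (4 + sq_radius t) + 2)\<^sup>2) * (2 * sq_radius t * ((u t $ 3)\<^sup>2 * W t))"
proof -
  let ?p = "\<lambda>i k. partial_deriv i F t $ k"
  have w: "partial_deriv 1 (winding_form 2) t - partial_deriv 2 (winding_form 1) t = 2 * (?p 1 1 * ?p 2 2 - ?p 1 2 * ?p 2 1)"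
    unfolding partial_deriv_winding_form partial_deriv_commute[OF C1(1,2), of 2 1] by (simp add: algebra_simps)
  have s: "partial_deriv 1 sq_radius t * winding_form 2 t - partial_deriv 2 sq_radius t * winding_form 1 t =
      2 * sq_radius t * (?p 1 1 * ?p 2 2 - ?p 1 2 * ?p 2 1)"
    unfolding partial_deriv_sq_radius winding_form_def sq_radius_def by algebra
  have split: "(w * (n * a2 + m1 * l2) + c * s1 * (n * l2)) - (w * (n * a1 + m2 * l1) + c * s2 * (n * l1)) =
      w * ((m1 * l2 - m2 * l1) + n * (a2 - a1)) + c * (n * (s1 * l2 - s2 * l1))"
    for w n a1 a2 m1 m2 l1 l2 c s1 s2 :: real
    by (simp add: algebra_simps)
  have square: "w * (x + n * (2 * (n * v))) + c * (n * (2 * r * (n * v))) = w * (x + 2 * (n\<^sup>2 * v)) + c * (2 * r * (n\<^sup>2 * v))"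
    for w x n v c r :: real
    by (simp add: power2_eq_square algebra_simps)
  show ?thesis
    unfolding partial_deriv_\<omega> split w s jacobian_eq by (rule square)
qed

lemma periodic_partial_deriv: "partial_deriv j F (t + axis i 1) = partial_deriv j F t"
  using partial_deriv_shift(2)[OF C1(1), of j "axis i 1" t] periodic by simp

lemma periodic_tangent: "P j (t + axis i 1) = P j t"
  by (simp add: tangent_def periodic periodic_partial_deriv)

lemma periodic_\<omega>: "\<omega> j (t + axis i 1) = \<omega> j t"
  by (simp add: \<omega>_def sq_radius_def winding_form_def unit_normal_def area_element_def
      periodic periodic_partial_deriv periodic_tangent)

definition energy_density :: "real ^ 2 \<Rightarrow> real" where
  "energy_density t = ((H t)\<^sup>2 - (u t $ 3)\<^sup>2 / 4) * W t"

lemma continuous_on_energy_density: "continuous_on UNIV energy_density"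
  unfolding energy_density_def[abs_def]
  by (intro continuous_intros continuous_on_mean_curv continuous_on_C_k_1[OF C_k_1_area]
      continuous_on_unit_normal) auto

definition corrected_density :: "real ^ 2 \<Rightarrow> real" where
  "corrected_density t = energy_density t + (partial_deriv 1 (\<omega> 2) t - partial_deriv 2 (\<omega> 1) t) / 8"

lemma continuous_on_corrected_density: "continuous_on UNIV corrected_density"
  unfolding corrected_density_def[abs_def]
  by (intro continuous_intros continuous_on_energy_density continuous_on_partial_deriv[OF C_k_1_\<omega>]) auto

lemma integral_corrected_density: "integral (cbox 0 1) corrected_density = integral (cbox 0 1) energy_density"
proof -
  have i: "f integrable_on cbox 0 1" if "continuous_on UNIV f" for f :: "real ^ 2 \<Rightarrow> real"
    by (intro integrable_continuous continuous_on_subset[OF that]) auto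
  note c = continuous_on_partial_deriv[OF C_k_1_\<omega>]
  have "integral (cbox 0 1) corrected_density = integral (cbox 0 1) energy_density +
      (integral (cbox 0 1) (partial_deriv 1 (\<omega> 2)) - integral (cbox 0 1) (partial_deriv 2 (\<omega> 1))) / 8"
  proof -
    have "integral (cbox 0 1) corrected_density = integral (cbox 0 1) energy_density +
      integral (cbox 0 1) (\<lambda>t. (partial_deriv 1 (\<omega> 2) t - partial_deriv 2 (\<omega> 1) t) / 8)"
      unfolding corrected_density_def[abs_def]
      by (intro Henstock_Kurzweil_Integration.integral_add i continuous_on_energy_density continuous_intros c) auto
    also have "integral (cbox 0 1) (\<lambda>t. (partial_deriv 1 (\<omega> 2) t - partial_deriv 2 (\<omega> 1) t) / 8) =
        integral (cbox 0 1) (\<lambda>t. partial_deriv 1 (\<omega> 2) t - partial_deriv 2 (\<omega> 1) t) / 8"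
      by (rule integral_divide)
    also have "integral (cbox 0 1) (\<lambda>t. partial_deriv 1 (\<omega> 2) t - partial_deriv 2 (\<omega> 1) t) =
        integral (cbox 0 1) (partial_deriv 1 (\<omega> 2)) - integral (cbox 0 1) (partial_deriv 2 (\<omega> 1))"
      by (intro Henstock_Kurzweil_Integration.integral_diff i c)
    finally show ?thesis .
  qed
  then show ?thesis
    using integral_partial_deriv_periodic[OF C_k_1_\<omega> periodic_\<omega>] by simp
qed

lemma rotation_gen_eq:
  "rotation_gen p = p $ 1 *\<^sub>R axis 2 1 - p $ 2 *\<^sub>R axis 1 1
     - ((p $ 1 * p $ 1 + p $ 2 * p $ 2) * (1 / 2)) *\<^sub>R axis 3 1"
  by (simp add: rotation_gen_def vec_eq_iff forall_3 axis_def power2_eq_square field_simps)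

lemma C_k_1_rotation_gen: "C_k 1 (\<lambda>t. rotation_gen (F t))"
  unfolding rotation_gen_eq
  by (intro C_k_1_diff C_k_1_add C_k_1_scaleR C_k_1_mult C_k_1_nth C_k_1_const C1)

lemma partial_deriv_rotation_gen:
  "partial_deriv i (\<lambda>t. rotation_gen (F t)) t =
     vector [- P i t $ 2, P i t $ 1, - (F t $ 1 * P i t $ 1 + F t $ 2 * P i t $ 2)]"
proof -
  have d: "partial_deriv i (\<lambda>t. F t $ 1 *\<^sub>R axis 2 (1::real) - F t $ 2 *\<^sub>R axis 1 1
     - ((F t $ 1 * F t $ 1 + F t $ 2 * F t $ 2) * (1 / 2)) *\<^sub>R axis 3 1 :: real ^ 3) t =
     partial_deriv i F t $ 1 *\<^sub>R axis 2 1 - partial_deriv i F t $ 2 *\<^sub>R axis 1 1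
     - (((F t $ 1 * partial_deriv i F t $ 1 + partial_deriv i F t $ 1 * F t $ 1) +
        (F t $ 2 * partial_deriv i F t $ 2 + partial_deriv i F t $ 2 * F t $ 2)) * (1 / 2)) *\<^sub>R axis 3 1"
    by (subst partial_deriv_diff partial_deriv_add partial_deriv_bilinear[OF bounded_bilinear_scaleR]
        partial_deriv_bilinear[OF bounded_bilinear_mult] partial_deriv_nth,
      (intro C_k_1_diff C_k_1_add C_k_1_scaleR C_k_1_mult C_k_1_nth C_k_1_const C1)+)+
      (simp add: partial_deriv_const)
  show ?thesis
    unfolding rotation_gen_eq d
    by (simp add: tangent_def frame_coords_def vec_eq_iff forall_3 axis_def field_simps)
qed

lemma unit_normal_rotation_gen: "u t \<bullet> rotation_gen (F t) = 0"
proof -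
  obtain a b where "a *\<^sub>R P 1 t + b *\<^sub>R P 2 t = rotation_gen (F t)" using rotation_tangent by blast
  then have "u t \<bullet> rotation_gen (F t) = u t \<bullet> (a *\<^sub>R P 1 t + b *\<^sub>R P 2 t)" by simp
  also have "\<dots> = 0" by (simp add: inner_add_right unit_normal_orth)
  finally show ?thesis .
qed

lemma rotation_gen_normal_deriv:
  "rotation_gen (F t) \<bullet> N i t = - u t \<bullet> vector [- P i t $ 2, P i t $ 1, - (F t $ 1 * P i t $ 1 + F t $ 2 * P i t $ 2)]"
  using inner_unit_normal_deriv[OF C_k_1_rotation_gen unit_normal_rotation_gen, of t i]
  unfolding partial_deriv_rotation_gen by (simp add: inner_commute)

text \<open>The angular component of the normal is determined by \<open>n\<^sub>3\<close> because the normal is orthogonal to the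
rotation field; the radial component is then known from the length of the normal.\<close>

lemma radial_component:
  "(F t $ 1 * u t $ 1 + F t $ 2 * u t $ 2)\<^sup>2 = sq_radius t * (1 - (u t $ 3)\<^sup>2 * (4 + sq_radius t) / 4)"
proof -
  let ?x = "F t $ 1" and ?y = "F t $ 2"
  have k: "?x * u t $ 2 - ?y * u t $ 1 = sq_radius t / 2 * u t $ 3"
    using unit_normal_rotation_gen[of t]
    by (simp add: rotation_gen_def inner_vec_def sum_3 sq_radius_def power2_eq_square field_simps)
  have n: "(u t $ 1)\<^sup>2 + (u t $ 2)\<^sup>2 + (u t $ 3)\<^sup>2 = 1"
    using unit_normal_unit[of t] by (simp add: inner_vec_def sum_3 power2_eq_square)
  have "(?x * u t $ 1 + ?y * u t $ 2)\<^sup>2 + (?x * u t $ 2 - ?y * u t $ 1)\<^sup>2 = sq_radius t * ((u t $ 1)\<^sup>2 + (u t $ 2)\<^sup>2)"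
    unfolding sq_radius_def by algebra
  also have "(u t $ 1)\<^sup>2 + (u t $ 2)\<^sup>2 = 1 - (u t $ 3)\<^sup>2" using n by simp
  finally show ?thesis unfolding k by (simp add: power2_eq_square field_simps)
qed

lemma corrected_density_eq:
  "corrected_density t = ((H t)\<^sup>2 - (u t $ 3)\<^sup>2 / 4) * W t +
    (2 * sqrt (4 + sq_radius t) / (sqrt (4 + sq_radius t) + 2) *
       ((N 1 t $ 3 * winding_form 2 t - N 2 t $ 3 * winding_form 1 t) + 2 * ((u t $ 3)\<^sup>2 * W t)) +
     2 / (sqrt (4 + sq_radius t) * (sqrt (4 + sq_radius t) + 2)\<^sup>2) * (2 * sq_radius t * ((u t $ 3)\<^sup>2 * W t))) / 8"
  unfolding corrected_density_def energy_density_def exterior_derivative_\<omega> weight_def ..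

lemma corrected_density_off_axis:
  assumes s: "0 < sq_radius t"
  shows "0 \<le> corrected_density t"
    and "F t $ 1 * u t $ 1 + F t $ 2 * u t $ 2 \<noteq> 0 \<Longrightarrow> 0 < corrected_density t"
proof -
  define R where "R = F t $ 1 * u t $ 1 + F t $ 2 * u t $ 2"
  define S where "S = sqrt (4 + sq_radius t)"
  have S2: "S\<^sup>2 = 4 + sq_radius t" using s by (simp add: S_def)
  have "2 \<le> S" unfolding S_def using s by (intro real_le_rsqrt) simp
  obtain a b where K: "a *\<^sub>R P 1 t + b *\<^sub>R P 2 t = rotation_gen (F t)" using rotation_tangent by blast
  have sq: "(F t $ 1)\<^sup>2 + (F t $ 2)\<^sup>2 = sq_radius t" by (simp add: sq_radius_def power2_eq_square)
  have wind: "F t $ 1 * P i t $ 2 - F t $ 2 * P i t $ 1 = winding_form i t" for i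
    by (simp add: winding_form_def tangent_def frame_coords_def)
  have "(4 + sq_radius t) * (N 1 t $ 3 * winding_form 2 t - N 2 t $ 3 * winding_form 1 t) =
     W t * (4 - (4 + 2 * sq_radius t) * (u t $ 3)\<^sup>2)
       - 4 * R * (u t \<bullet> (N 1 t \<times> P 2 t + P 1 t \<times> N 2 t))"
    using wedge_identity[OF W_pos unit_normal K unit_normal_unit unit_normal_deriv_orth unit_normal_deriv_orth
        rotation_gen_normal_deriv rotation_gen_normal_deriv unit_normal_deriv_asym] s
    unfolding sq wind R_def by simp
  moreover have "u t \<bullet> (N 1 t \<times> P 2 t + P 1 t \<times> N 2 t) = - 2 * H t * W t"
    unfolding mean_curv_def using W_pos[of t] by simp
  ultimately have L: "(4 + sq_radius t) * (N 1 t $ 3 * winding_form 2 t - N 2 t $ 3 * winding_form 1 t) =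
     W t * (4 - (4 + 2 * sq_radius t) * (u t $ 3)\<^sup>2) + 8 * H t * W t * R"
    by simp
  have R: "R\<^sup>2 = sq_radius t * (1 - (u t $ 3)\<^sup>2 * S\<^sup>2 / 4)"
    unfolding R_def S2 by (rule radial_component)
  note D = energy_density_off_axis[OF \<open>2 \<le> S\<close> _ s W_pos R L, folded corrected_density_eq[of t, folded S_def]]
  show "0 \<le> corrected_density t" by (rule D(1)) (simp add: S2)
  show "0 < corrected_density t" if "F t $ 1 * u t $ 1 + F t $ 2 * u t $ 2 \<noteq> 0"
    by (rule D(2)) (use that in \<open>simp_all add: S2 R_def\<close>)
qed

lemma corrected_density_nonneg: "0 \<le> corrected_density t"
proof (cases "sq_radius t = 0")
  case True
  \<comment> \<open>On the axis \<open>\<omega>\<close> contributes exactly the term that cancels \<open>- n\<^sub>3\<^sup>2 / 4\<close>.\<close>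
  then have "F t $ 1 = 0" "F t $ 2 = 0"
    unfolding sq_radius_def using sum_squares_eq_zero_iff by blast+
  then have "corrected_density t = (H t)\<^sup>2 * W t"
    unfolding corrected_density_eq True winding_form_def by (simp add: algebra_simps)
  then show ?thesis using W_pos[of t] by simp
next
  case False
  then show ?thesis using corrected_density_off_axis(1)[of t] sq_radius_nonneg[of t] by simp
qed

lemma sq_radius_pos: "\<exists>t. 0 < sq_radius t"
proof (rule ccontr)
  assume "\<nexists>t. 0 < sq_radius t"
  then have "sq_radius t = 0" for t using sq_radius_nonneg[of t] by (intro antisym) (auto simp: not_less)
  then have 0: "F t $ 1 = 0" "F t $ 2 = 0" for t
    unfolding sq_radius_def using sum_squares_eq_zero_iff by blast+
  have "partial_deriv i F t $ 1 = 0" "partial_deriv i F t $ 2 = 0" for i t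
    unfolding partial_deriv_nth[OF C1(1), symmetric] 0 by (rule partial_deriv_const)+
  then have "P 1 t \<times> P 2 t = 0" for t
    by (simp add: tangent_def frame_coords_def cross3_def vec_eq_iff forall_3)
  then show False using W_pos[of 0] by (simp add: area_element_def)
qed

text \<open>At a point farthest from the axis the normal is horizontal and orthogonal to the rotation field,
hence radial, and its radial component does not vanish.\<close>

lemma corrected_density_pos_at_max:
  assumes max: "\<And>r. sq_radius r \<le> sq_radius t"
  shows "0 < corrected_density t"
proof -
  have s: "0 < sq_radius t" using sq_radius_pos max less_le_trans by blast
  have crit: "partial_deriv i sq_radius t = 0" for i
  proof -
    have d: "((\<lambda>h. sq_radius (t + h *\<^sub>R axis i 1)) has_real_derivative partial_deriv i sq_radius t) (at 0)"
      using partial_deriv_along_line[OF C_k_1_sq_radius, of t i 0]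
      unfolding has_real_derivative_iff_has_vector_derivative by simp
    show ?thesis
      by (rule DERIV_local_max[OF d, of 1]) (use max in auto)
  qed
  have c: "F t $ 1 * partial_deriv i F t $ 1 + F t $ 2 * partial_deriv i F t $ 2 = 0" for i
    using crit[of i] unfolding partial_deriv_sq_radius by simp
  have "sq_radius t * (partial_deriv 1 F t $ 1 * partial_deriv 2 F t $ 2 - partial_deriv 1 F t $ 2 * partial_deriv 2 F t $ 1) = 0"
    unfolding sq_radius_def using c[of 1] c[of 2] by algebra
  then have "u t $ 3 = 0" using s W_pos[of t] unfolding jacobian_eq by simp
  then have "(F t $ 1 * u t $ 1 + F t $ 2 * u t $ 2)\<^sup>2 = sq_radius t"
    unfolding radial_component by simp
  then have "F t $ 1 * u t $ 1 + F t $ 2 * u t $ 2 \<noteq> 0" using s by auto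
  then show ?thesis by (rule corrected_density_off_axis(2)[OF s])
qed

end

theorem corollary2:
  fixes M :: "nil set" and F :: "real ^ 2 \<Rightarrow> nil" and n :: "real ^ 2 \<Rightarrow> real ^ 3"
  assumes "torus_of_revolution M"
    and "torus_parametrization M F"
    and "unit_normal_field F n"
  shows "spinor_energy F n > 0"
proof -
  interpret immersion F
    using assms(2) unfolding torus_parametrization_def by unfold_locales blast+
  interpret torus_immersion F
  proof
    show "F (t + axis i 1) = F t" for t i
      using assms(2) unfolding torus_parametrization_def by (auto simp: axis_def)
    show "\<exists>a b. a *\<^sub>R P 1 t + b *\<^sub>R P 2 t = rotation_gen (F t)" for t
    proof -
      let ?L = "frechet_derivative F (at t)"
      have lin: "linear ?L" using has_derivative_frechet_C_k_1[OF C1(1)] has_derivative_linear by blast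
      obtain v where v: "vector [- F t $ 2, F t $ 1, ((F t $ 1)\<^sup>2 - (F t $ 2)\<^sup>2) / 2] = ?L v"
        using rotation_velocity_in_tangent_plane[OF assms(1,2) C1(1)] by blast
      have "v = v $ 1 *\<^sub>R axis 1 1 + v $ 2 *\<^sub>R axis 2 1"
        by (simp add: vec_eq_iff forall_2 axis_def)
      then have "?L v = v $ 1 *\<^sub>R partial_deriv 1 F t + v $ 2 *\<^sub>R partial_deriv 2 F t"
        unfolding partial_deriv_def by (metis linear_add[OF lin] linear_scale[OF lin])
      then have "v $ 1 *\<^sub>R P 1 t + v $ 2 *\<^sub>R P 2 t = frame_coords (F t) (?L v)"
        unfolding tangent_def by (simp add: linear_add[OF linear_frame_coords] linear_scale[OF linear_frame_coords])
      also have "\<dots> = rotation_gen (F t)"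
        unfolding v[symmetric] by (simp add: frame_coords_def rotation_gen_def vec_eq_iff forall_3 power2_eq_square field_simps)
      finally show ?thesis by blast
    qed
  qed
  have "continuous_on (cbox 0 1) sq_radius"
    by (rule continuous_on_subset[OF continuous_on_C_k_1[OF C_k_1_sq_radius]]) simp
  moreover have "cbox 0 (1 :: real ^ 2) \<noteq> {}" by (simp add: interval_ne_empty_cart)
  ultimately obtain t where t: "t \<in> cbox 0 1" "\<And>r. r \<in> cbox 0 1 \<Longrightarrow> sq_radius r \<le> sq_radius t"
    using continuous_attains_sup[of "cbox 0 (1 :: real ^ 2)" sq_radius] compact_cbox by blast
  have "sq_radius r \<le> sq_radius t" for r
  proof -
    have "F r \<in> M" using assms(2) unfolding torus_parametrization_def by blast
    then obtain r' where r': "F r' = F r" "\<And>i. \<bar>r' $ i - (\<chi> i. 1 / 2) $ i\<bar> \<le> 1 / 2"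
      using torus_parametrization_near[OF assms(2)] by blast
    have "0 \<le> r' $ i \<and> r' $ i \<le> 1" for i
    proof -
      have "\<bar>r' $ i - 1 / 2\<bar> \<le> 1 / 2" using r'(2)[of i] by simp
      then show ?thesis by linarith
    qed
    then have "r' \<in> cbox 0 1" by (simp add: mem_box_cart)
    then have "sq_radius r' \<le> sq_radius t" by (rule t(2))
    then show ?thesis by (simp add: sq_radius_def r'(1))
  qed
  then have "0 < corrected_density t" by (rule corrected_density_pos_at_max)
  then have "0 < integral (cbox 0 1) corrected_density"
    by (intro integral_unit_square_pos[OF continuous_on_corrected_density corrected_density_nonneg t(1)])
  moreover have "spinor_energy F n = 1 / 4 * integral (cbox 0 1) energy_density"
    unfolding spinor_energy_def energy_density_def[abs_def] mean_curvature_eq[OF assms(3)] area_density_eq ..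
  ultimately show ?thesis unfolding integral_corrected_density by simp
qed

end
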